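(* Let $\mathcal{E}$ be a category with pullbacks, finite products and an (epimorphism, monomorphism) orthogonal factorisation system. Then the following are equivalent. (1) The category $\mathcal{E}$ satisfies the external axiom of choice. (2) The $2$-category $\mathbf{Cat}(\mathcal{E})$ satisfies the categorified axiom of choice.
   Context: $\mathbf{Cat}(\mathcal{E})$ is the $2$-category of categories, functors and natural transformations internal to $\mathcal{E}$. A category satisfies the external axiom of choice if every epimorphism $e:X\to Y$ has a section, i.e. $s:Y\to X$ with $es=1_Y$. In a $2$-category $\mathcal{K}$: a morphism $f$ is fully faithful if every functor $\mathcal{K}(Z,f)$ is fully faithful; a full (= fully faithful) monomorphism is an $f$ such that every $\mathcal{K}(Z,f)$ is fully faithful and injective on objects. For $s:A\to B$ and $f:X\to Y$ write $s\perp f$ if (i) for all $p:A\to X$, $q:B\to Y$ with $fp=qs$ there is a unique $u:B\to X$ with $fu=q$ and $us=p$; and (ii) for all $2$-cells $\alpha:p\Rightarrow p'$, $\beta:q\Rightarrow q'$ with $fp=qs$, $fp'=q's$, $f\alpha=\beta s$, and induced $u,u'$, there is a unique $2$-cell $\gamma:u\Rightarrow u'$ with $f\gamma=\beta$ and $\gamma s=\alpha$. A morphism $s$ is acute if $s\perp f$ for all full monomorphisms $f$. $\mathcal{K}$ satisfies the categorified axiom of choice if every acute fully faithful morphism has a section. *)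

theory Defs
  imports Main
begin

section \<open>Categories\<close>

record ('o, 'a) cat =
  Ob :: "'o set"
  Ar :: "'a set"
  Dom :: "'a \<Rightarrow> 'o"
  Cod :: "'a \<Rightarrow> 'o"
  Ide :: "'o \<Rightarrow> 'a"
  Comp :: "'a \<Rightarrow> 'a \<Rightarrow> 'a" (infixr "\<cdot>\<index>" 70)

definition hom :: "('o, 'a, 'm) cat_scheme \<Rightarrow> 'o \<Rightarrow> 'o \<Rightarrow> 'a set" where
  "hom E A B = {f \<in> Ar E. Dom E f = A \<and> Cod E f = B}"

locale category =
  fixes E :: "('o, 'a, 'm) cat_scheme" (structure)
  assumes Dom_Ob: "f \<in> Ar E \<Longrightarrow> Dom E f \<in> Ob E"
    and Cod_Ob: "f \<in> Ar E \<Longrightarrow> Cod E f \<in> Ob E"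
    and Ide_hom: "A \<in> Ob E \<Longrightarrow> Ide E A \<in> hom E A A"
    and Comp_hom: "f \<in> hom E A B \<Longrightarrow> g \<in> hom E B C \<Longrightarrow> g \<cdot> f \<in> hom E A C"
    and Comp_Ide: "f \<in> hom E A B \<Longrightarrow> f \<cdot> Ide E A = f"
    and Ide_Comp: "f \<in> hom E A B \<Longrightarrow> Ide E B \<cdot> f = f"
    and Comp_assoc: "f \<in> hom E A B \<Longrightarrow> g \<in> hom E B C \<Longrightarrow> h \<in> hom E C D
      \<Longrightarrow> (h \<cdot> g) \<cdot> f = h \<cdot> (g \<cdot> f)"

definition epic :: "('o, 'a, 'm) cat_scheme \<Rightarrow> 'a \<Rightarrow> bool" where
  "epic E e \<longleftrightarrow> e \<in> Ar E \<and>
    (\<forall>B. \<forall>g \<in> hom E (Cod E e) B. \<forall>h \<in> hom E (Cod E e) B. g \<cdot>\<^bsub>E\<^esub> e = h \<cdot>\<^bsub>E\<^esub> e \<longrightarrow> g = h)"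

definition monic :: "('o, 'a, 'm) cat_scheme \<Rightarrow> 'a \<Rightarrow> bool" where
  "monic E m \<longleftrightarrow> m \<in> Ar E \<and>
    (\<forall>A. \<forall>g \<in> hom E A (Dom E m). \<forall>h \<in> hom E A (Dom E m). m \<cdot>\<^bsub>E\<^esub> g = m \<cdot>\<^bsub>E\<^esub> h \<longrightarrow> g = h)"

definition has_section :: "('o, 'a, 'm) cat_scheme \<Rightarrow> 'a \<Rightarrow> bool" where
  "has_section E e \<longleftrightarrow> (\<exists>s \<in> hom E (Cod E e) (Dom E e). e \<cdot>\<^bsub>E\<^esub> s = Ide E (Cod E e))"

definition external_choice :: "('o, 'a, 'm) cat_scheme \<Rightarrow> bool" where
  "external_choice E \<longleftrightarrow> (\<forall>e. epic E e \<longrightarrow> has_section E e)"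

definition orthogonal :: "('o, 'a, 'm) cat_scheme \<Rightarrow> 'a \<Rightarrow> 'a \<Rightarrow> bool" where
  "orthogonal E e m \<longleftrightarrow>
    (\<forall>p \<in> hom E (Dom E e) (Dom E m). \<forall>q \<in> hom E (Cod E e) (Cod E m).
      m \<cdot>\<^bsub>E\<^esub> p = q \<cdot>\<^bsub>E\<^esub> e \<longrightarrow>
      (\<exists>!u. u \<in> hom E (Cod E e) (Dom E m) \<and> m \<cdot>\<^bsub>E\<^esub> u = q \<and> u \<cdot>\<^bsub>E\<^esub> e = p))"

definition orthogonal_factorisation_system ::
  "('o, 'a, 'm) cat_scheme \<Rightarrow> 'a set \<Rightarrow> 'a set \<Rightarrow> bool" where
  "orthogonal_factorisation_system E L R \<longleftrightarrow>
    L = {e \<in> Ar E. \<forall>m \<in> R. orthogonal E e m} \<and>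
    R = {m \<in> Ar E. \<forall>e \<in> L. orthogonal E e m} \<and>
    (\<forall>f \<in> Ar E. \<exists>e \<in> L. \<exists>m \<in> R. Cod E e = Dom E m \<and> f = m \<cdot>\<^bsub>E\<^esub> e)"

definition is_pullback :: "('o, 'a, 'm) cat_scheme \<Rightarrow> 'a \<Rightarrow> 'a \<Rightarrow> 'a \<Rightarrow> 'a \<Rightarrow> bool" where
  "is_pullback E f g p q \<longleftrightarrow>
    p \<in> hom E (Dom E p) (Dom E f) \<and> q \<in> hom E (Dom E p) (Dom E g) \<and>
    f \<cdot>\<^bsub>E\<^esub> p = g \<cdot>\<^bsub>E\<^esub> q \<and>
    (\<forall>Z. \<forall>a \<in> hom E Z (Dom E f). \<forall>b \<in> hom E Z (Dom E g). f \<cdot>\<^bsub>E\<^esub> a = g \<cdot>\<^bsub>E\<^esub> b \<longrightarrow>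
      (\<exists>!u. u \<in> hom E Z (Dom E p) \<and> p \<cdot>\<^bsub>E\<^esub> u = a \<and> q \<cdot>\<^bsub>E\<^esub> u = b))"

definition has_pullbacks :: "('o, 'a, 'm) cat_scheme \<Rightarrow> bool" where
  "has_pullbacks E \<longleftrightarrow>
    (\<forall>f \<in> Ar E. \<forall>g \<in> Ar E. Cod E f = Cod E g \<longrightarrow> (\<exists>p q. is_pullback E f g p q))"

definition is_product ::
  "('o, 'a, 'm) cat_scheme \<Rightarrow> nat \<Rightarrow> (nat \<Rightarrow> 'o) \<Rightarrow> 'o \<Rightarrow> (nat \<Rightarrow> 'a) \<Rightarrow> bool" where
  "is_product E n X P \<pi> \<longleftrightarrow> P \<in> Ob E \<and> (\<forall>i<n. \<pi> i \<in> hom E P (X i)) \<and>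
    (\<forall>Z \<in> Ob E. \<forall>a. (\<forall>i<n. a i \<in> hom E Z (X i)) \<longrightarrow>
      (\<exists>!u. u \<in> hom E Z P \<and> (\<forall>i<n. \<pi> i \<cdot>\<^bsub>E\<^esub> u = a i)))"

definition has_finite_products :: "('o, 'a, 'm) cat_scheme \<Rightarrow> bool" where
  "has_finite_products E \<longleftrightarrow>
    (\<forall>n X. (\<forall>i<n. X i \<in> Ob E) \<longrightarrow> (\<exists>P \<pi>. is_product E n X P \<pi>))"

text \<open>A fixed choice of pullbacks; \<open>tup E f g a b\<close> is the arrow into the chosen pullback of
  \<open>f\<close> and \<open>g\<close> with components \<open>a\<close> and \<open>b\<close>.\<close>

definition pb :: "('o, 'a, 'm) cat_scheme \<Rightarrow> 'a \<Rightarrow> 'a \<Rightarrow> 'a \<times> 'a" where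
  "pb E f g = (SOME pq. is_pullback E f g (fst pq) (snd pq))"

definition pb1 :: "('o, 'a, 'm) cat_scheme \<Rightarrow> 'a \<Rightarrow> 'a \<Rightarrow> 'a" where
  "pb1 E f g = fst (pb E f g)"

definition pb2 :: "('o, 'a, 'm) cat_scheme \<Rightarrow> 'a \<Rightarrow> 'a \<Rightarrow> 'a" where
  "pb2 E f g = snd (pb E f g)"

definition pbo :: "('o, 'a, 'm) cat_scheme \<Rightarrow> 'a \<Rightarrow> 'a \<Rightarrow> 'o" where
  "pbo E f g = Dom E (pb1 E f g)"

definition tup :: "('o, 'a, 'm) cat_scheme \<Rightarrow> 'a \<Rightarrow> 'a \<Rightarrow> 'a \<Rightarrow> 'a \<Rightarrow> 'a" where
  "tup E f g a b = (THE u. u \<in> hom E (Dom E a) (pbo E f g) \<and>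
    pb1 E f g \<cdot>\<^bsub>E\<^esub> u = a \<and> pb2 E f g \<cdot>\<^bsub>E\<^esub> u = b)"


section \<open>2-categories\<close>

text \<open>The inherited fields form the underlying category of objects and 1-cells.\<close>

record ('o, 'a, 'c) two_cat = "('o, 'a) cat" +
  Cell :: "'c set"
  CDom :: "'c \<Rightarrow> 'a"
  CCod :: "'c \<Rightarrow> 'a"
  CIde :: "'a \<Rightarrow> 'c"
  VComp :: "'c \<Rightarrow> 'c \<Rightarrow> 'c" (infixr "\<bullet>\<index>" 70)
  HComp :: "'c \<Rightarrow> 'c \<Rightarrow> 'c" (infixr "\<star>\<index>" 70)

definition cells :: "('o, 'a, 'c, 'm) two_cat_scheme \<Rightarrow> 'a \<Rightarrow> 'a \<Rightarrow> 'c set" where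
  "cells K f g = {\<alpha> \<in> Cell K. CDom K \<alpha> = f \<and> CCod K \<alpha> = g}"

locale two_category = category K
  for K :: "('o, 'a, 'c, 'm) two_cat_scheme" (structure) +
  assumes CDom_Ar: "\<alpha> \<in> Cell K \<Longrightarrow> CDom K \<alpha> \<in> Ar K"
    and CCod_hom: "\<alpha> \<in> Cell K \<Longrightarrow> CCod K \<alpha> \<in> hom K (Dom K (CDom K \<alpha>)) (Cod K (CDom K \<alpha>))"
    and CIde_cells: "f \<in> Ar K \<Longrightarrow> CIde K f \<in> cells K f f"
    and VComp_cells: "\<alpha> \<in> cells K f g \<Longrightarrow> \<beta> \<in> cells K g h \<Longrightarrow> \<beta> \<bullet> \<alpha> \<in> cells K f h"
    and VComp_CIde: "\<alpha> \<in> cells K f g \<Longrightarrow> \<alpha> \<bullet> CIde K f = \<alpha>"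
    and CIde_VComp: "\<alpha> \<in> cells K f g \<Longrightarrow> CIde K g \<bullet> \<alpha> = \<alpha>"
    and VComp_assoc: "\<alpha> \<in> cells K f g \<Longrightarrow> \<beta> \<in> cells K g h \<Longrightarrow> \<gamma> \<in> cells K h k
      \<Longrightarrow> (\<gamma> \<bullet> \<beta>) \<bullet> \<alpha> = \<gamma> \<bullet> (\<beta> \<bullet> \<alpha>)"
    and HComp_cells: "\<alpha> \<in> cells K f g \<Longrightarrow> \<beta> \<in> cells K h k \<Longrightarrow> Cod K f = Dom K h
      \<Longrightarrow> \<beta> \<star> \<alpha> \<in> cells K (h \<cdot> f) (k \<cdot> g)"
    and HComp_CIde: "\<alpha> \<in> cells K f g \<Longrightarrow> \<alpha> \<star> CIde K (Ide K (Dom K f)) = \<alpha>"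
    and CIde_HComp: "\<alpha> \<in> cells K f g \<Longrightarrow> CIde K (Ide K (Cod K f)) \<star> \<alpha> = \<alpha>"
    and HComp_assoc: "\<alpha> \<in> cells K f g \<Longrightarrow> \<beta> \<in> cells K h k \<Longrightarrow> \<gamma> \<in> cells K l n
      \<Longrightarrow> Cod K f = Dom K h \<Longrightarrow> Cod K h = Dom K l
      \<Longrightarrow> (\<gamma> \<star> \<beta>) \<star> \<alpha> = \<gamma> \<star> (\<beta> \<star> \<alpha>)"
    and CIde_Comp: "f \<in> hom K A B \<Longrightarrow> g \<in> hom K B C \<Longrightarrow> CIde K g \<star> CIde K f = CIde K (g \<cdot> f)"
    and interchange: "\<alpha> \<in> cells K f g \<Longrightarrow> \<alpha>' \<in> cells K g h \<Longrightarrow>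
      \<beta> \<in> cells K k l \<Longrightarrow> \<beta>' \<in> cells K l n \<Longrightarrow> Cod K f = Dom K k
      \<Longrightarrow> (\<beta>' \<bullet> \<beta>) \<star> (\<alpha>' \<bullet> \<alpha>) = (\<beta>' \<star> \<alpha>') \<bullet> (\<beta> \<star> \<alpha>)"

definition lwhisker :: "('o, 'a, 'c, 'm) two_cat_scheme \<Rightarrow> 'a \<Rightarrow> 'c \<Rightarrow> 'c" where
  "lwhisker K f \<alpha> = CIde K f \<star>\<^bsub>K\<^esub> \<alpha>"

definition rwhisker :: "('o, 'a, 'c, 'm) two_cat_scheme \<Rightarrow> 'c \<Rightarrow> 'a \<Rightarrow> 'c" where
  "rwhisker K \<alpha> f = \<alpha> \<star>\<^bsub>K\<^esub> CIde K f"

text \<open>The functor \<open>K(Z, f)\<close> sends \<open>g\<close> to \<open>f g\<close> and \<open>\<alpha>\<close> to \<open>f \<alpha>\<close>.\<close>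

definition fully_faithful :: "('o, 'a, 'c, 'm) two_cat_scheme \<Rightarrow> 'a \<Rightarrow> bool" where
  "fully_faithful K f \<longleftrightarrow> f \<in> Ar K \<and>
    (\<forall>Z \<in> Ob K. \<forall>g \<in> hom K Z (Dom K f). \<forall>h \<in> hom K Z (Dom K f).
      bij_betw (lwhisker K f) (cells K g h) (cells K (f \<cdot>\<^bsub>K\<^esub> g) (f \<cdot>\<^bsub>K\<^esub> h)))"

definition full_mono :: "('o, 'a, 'c, 'm) two_cat_scheme \<Rightarrow> 'a \<Rightarrow> bool" where
  "full_mono K f \<longleftrightarrow> fully_faithful K f \<and>
    (\<forall>Z \<in> Ob K. inj_on (\<lambda>g. f \<cdot>\<^bsub>K\<^esub> g) (hom K Z (Dom K f)))"

definition orthogonal2 :: "('o, 'a, 'c, 'm) two_cat_scheme \<Rightarrow> 'a \<Rightarrow> 'a \<Rightarrow> bool" where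
  "orthogonal2 K s f \<longleftrightarrow> orthogonal K s f \<and>
    (\<forall>p \<in> hom K (Dom K s) (Dom K f). \<forall>p' \<in> hom K (Dom K s) (Dom K f).
     \<forall>q \<in> hom K (Cod K s) (Cod K f). \<forall>q' \<in> hom K (Cod K s) (Cod K f).
     \<forall>u \<in> hom K (Cod K s) (Dom K f). \<forall>u' \<in> hom K (Cod K s) (Dom K f).
     \<forall>\<alpha> \<in> cells K p p'. \<forall>\<beta> \<in> cells K q q'.
      f \<cdot>\<^bsub>K\<^esub> p = q \<cdot>\<^bsub>K\<^esub> s \<and> f \<cdot>\<^bsub>K\<^esub> p' = q' \<cdot>\<^bsub>K\<^esub> s \<and> lwhisker K f \<alpha> = rwhisker K \<beta> s \<and>
      f \<cdot>\<^bsub>K\<^esub> u = q \<and> u \<cdot>\<^bsub>K\<^esub> s = p \<and> f \<cdot>\<^bsub>K\<^esub> u' = q' \<and> u' \<cdot>\<^bsub>K\<^esub> s = p' \<longrightarrow>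
      (\<exists>!\<gamma>. \<gamma> \<in> cells K u u' \<and> lwhisker K f \<gamma> = \<beta> \<and> rwhisker K \<gamma> s = \<alpha>))"

definition acute :: "('o, 'a, 'c, 'm) two_cat_scheme \<Rightarrow> 'a \<Rightarrow> bool" where
  "acute K s \<longleftrightarrow> s \<in> Ar K \<and> (\<forall>f. full_mono K f \<longrightarrow> orthogonal2 K s f)"

definition categorified_choice :: "('o, 'a, 'c, 'm) two_cat_scheme \<Rightarrow> bool" where
  "categorified_choice K \<longleftrightarrow> (\<forall>f. acute K f \<and> fully_faithful K f \<longrightarrow> has_section K f)"


section \<open>Internal categories, functors and natural transformations\<close>

text \<open>The composition \<open>imul\<close> is defined on the pullback of \<open>itgt\<close> along \<open>isrc\<close>, so it takes the arrow
  applied first as its first component.\<close>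

record ('o, 'a) icat =
  iob :: 'o
  iarr :: 'o
  isrc :: 'a
  itgt :: 'a
  iunit :: 'a
  imul :: 'a

record ('o, 'a) ifun =
  fdom :: "('o, 'a) icat"
  fcod :: "('o, 'a) icat"
  fob :: 'a
  farr :: 'a

record ('o, 'a) inat =
  ndom :: "('o, 'a) ifun"
  ncod :: "('o, 'a) ifun"
  ncomp :: 'a

text \<open>The composite, in diagrammatic order, of generalised arrows \<open>a, b : Z \<rightarrow> iarr C\<close>.\<close>

definition icomp :: "('o, 'a, 'm) cat_scheme \<Rightarrow> ('o, 'a) icat \<Rightarrow> 'a \<Rightarrow> 'a \<Rightarrow> 'a" where
  "icomp E C a b = imul C \<cdot>\<^bsub>E\<^esub> tup E (itgt C) (isrc C) a b"

text \<open>In the associativity axiom, the object of composable triples is the pullback of the second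
  projection along the first projection of the object of composable pairs.\<close>

definition internal_category :: "('o, 'a, 'm) cat_scheme \<Rightarrow> ('o, 'a) icat \<Rightarrow> bool" where
  "internal_category E C \<longleftrightarrow>
    (let s = isrc C; t = itgt C; i = iunit C; m = imul C;
         p = pb1 E t s; q = pb2 E t s; r1 = pb1 E q p; r2 = pb2 E q p
     in iob C \<in> Ob E \<and> iarr C \<in> Ob E \<and>
        s \<in> hom E (iarr C) (iob C) \<and> t \<in> hom E (iarr C) (iob C) \<and>
        i \<in> hom E (iob C) (iarr C) \<and> m \<in> hom E (pbo E t s) (iarr C) \<and>
        s \<cdot>\<^bsub>E\<^esub> i = Ide E (iob C) \<and> t \<cdot>\<^bsub>E\<^esub> i = Ide E (iob C) \<and>
        s \<cdot>\<^bsub>E\<^esub> m = s \<cdot>\<^bsub>E\<^esub> p \<and> t \<cdot>\<^bsub>E\<^esub> m = t \<cdot>\<^bsub>E\<^esub> q \<and>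
        icomp E C (i \<cdot>\<^bsub>E\<^esub> s) (Ide E (iarr C)) = Ide E (iarr C) \<and>
        icomp E C (Ide E (iarr C)) (i \<cdot>\<^bsub>E\<^esub> t) = Ide E (iarr C) \<and>
        icomp E C (m \<cdot>\<^bsub>E\<^esub> r1) (q \<cdot>\<^bsub>E\<^esub> r2) = icomp E C (p \<cdot>\<^bsub>E\<^esub> r1) (m \<cdot>\<^bsub>E\<^esub> r2))"

definition internal_functor :: "('o, 'a, 'm) cat_scheme \<Rightarrow> ('o, 'a) ifun \<Rightarrow> bool" where
  "internal_functor E F \<longleftrightarrow>
    (let A = fdom F; B = fcod F; p = pb1 E (itgt A) (isrc A); q = pb2 E (itgt A) (isrc A)
     in internal_category E A \<and> internal_category E B \<and>
        fob F \<in> hom E (iob A) (iob B) \<and> farr F \<in> hom E (iarr A) (iarr B) \<and>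
        isrc B \<cdot>\<^bsub>E\<^esub> farr F = fob F \<cdot>\<^bsub>E\<^esub> isrc A \<and>
        itgt B \<cdot>\<^bsub>E\<^esub> farr F = fob F \<cdot>\<^bsub>E\<^esub> itgt A \<and>
        farr F \<cdot>\<^bsub>E\<^esub> iunit A = iunit B \<cdot>\<^bsub>E\<^esub> fob F \<and>
        farr F \<cdot>\<^bsub>E\<^esub> imul A = icomp E B (farr F \<cdot>\<^bsub>E\<^esub> p) (farr F \<cdot>\<^bsub>E\<^esub> q))"

definition internal_nat :: "('o, 'a, 'm) cat_scheme \<Rightarrow> ('o, 'a) inat \<Rightarrow> bool" where
  "internal_nat E \<alpha> \<longleftrightarrow>
    (let F = ndom \<alpha>; G = ncod \<alpha>; A = fdom F; B = fcod F; a = ncomp \<alpha>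
     in internal_functor E F \<and> internal_functor E G \<and> fdom G = A \<and> fcod G = B \<and>
        a \<in> hom E (iob A) (iarr B) \<and>
        isrc B \<cdot>\<^bsub>E\<^esub> a = fob F \<and> itgt B \<cdot>\<^bsub>E\<^esub> a = fob G \<and>
        icomp E B (a \<cdot>\<^bsub>E\<^esub> isrc A) (farr G) = icomp E B (farr F) (a \<cdot>\<^bsub>E\<^esub> itgt A))"

definition Cat :: "('o, 'a, 'm) cat_scheme \<Rightarrow>
    (('o, 'a) icat, ('o, 'a) ifun, ('o, 'a) inat) two_cat" where
  "Cat E = \<lparr>
    Ob = {C. internal_category E C},
    Ar = {F. internal_functor E F},
    Dom = fdom,
    Cod = fcod,
    Ide = (\<lambda>A. \<lparr>fdom = A, fcod = A, fob = Ide E (iob A), farr = Ide E (iarr A)\<rparr>),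
    Comp = (\<lambda>G F. \<lparr>fdom = fdom F, fcod = fcod G,
      fob = fob G \<cdot>\<^bsub>E\<^esub> fob F, farr = farr G \<cdot>\<^bsub>E\<^esub> farr F\<rparr>),
    Cell = {\<alpha>. internal_nat E \<alpha>},
    CDom = ndom,
    CCod = ncod,
    CIde = (\<lambda>F. \<lparr>ndom = F, ncod = F, ncomp = iunit (fcod F) \<cdot>\<^bsub>E\<^esub> fob F\<rparr>),
    VComp = (\<lambda>\<beta> \<alpha>. \<lparr>ndom = ndom \<alpha>, ncod = ncod \<beta>,
      ncomp = icomp E (fcod (ndom \<alpha>)) (ncomp \<alpha>) (ncomp \<beta>)\<rparr>),
    HComp = (\<lambda>\<beta> \<alpha>. \<lparr>
      ndom = \<lparr>fdom = fdom (ndom \<alpha>), fcod = fcod (ndom \<beta>),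
        fob = fob (ndom \<beta>) \<cdot>\<^bsub>E\<^esub> fob (ndom \<alpha>), farr = farr (ndom \<beta>) \<cdot>\<^bsub>E\<^esub> farr (ndom \<alpha>)\<rparr>,
      ncod = \<lparr>fdom = fdom (ncod \<alpha>), fcod = fcod (ncod \<beta>),
        fob = fob (ncod \<beta>) \<cdot>\<^bsub>E\<^esub> fob (ncod \<alpha>), farr = farr (ncod \<beta>) \<cdot>\<^bsub>E\<^esub> farr (ncod \<alpha>)\<rparr>,
      ncomp = icomp E (fcod (ndom \<beta>)) (farr (ndom \<beta>) \<cdot>\<^bsub>E\<^esub> ncomp \<alpha>) (ncomp \<beta> \<cdot>\<^bsub>E\<^esub> fob (ncod \<alpha>))\<rparr>)\<rparr>"


section \<open>\<open>Cat E\<close> is a 2-category\<close>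

locale pullback_category = category +
  assumes pullbacks: "has_pullbacks E"
begin

lemma homD: "f \<in> hom E A B \<Longrightarrow> f \<in> Ar E \<and> Dom E f = A \<and> Cod E f = B"
  by (simp add: hom_def)

lemma hom_Ob: "f \<in> hom E A B \<Longrightarrow> A \<in> Ob E \<and> B \<in> Ob E"
  using Dom_Ob Cod_Ob by (auto simp: hom_def)

lemma is_pullback_pb:
  assumes "f \<in> hom E A C" "g \<in> hom E B C"
  shows "is_pullback E f g (pb1 E f g) (pb2 E f g)"
proof -
  have "\<exists>pq. is_pullback E f g (fst pq) (snd pq)"
    using pullbacks assms unfolding has_pullbacks_def by (fastforce dest: homD)
  then show ?thesis unfolding pb1_def pb2_def pb_def by (rule someI_ex)
qed

lemma pb_hom:
  assumes "f \<in> hom E A C" "g \<in> hom E B C"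
  shows "pb1 E f g \<in> hom E (pbo E f g) A" "pb2 E f g \<in> hom E (pbo E f g) B"
    "f \<cdot> pb1 E f g = g \<cdot> pb2 E f g"
proof -
  have "Dom E f = A" "Dom E g = B" using assms homD by blast+
  with is_pullback_pb[OF assms] show "pb1 E f g \<in> hom E (pbo E f g) A"
    "pb2 E f g \<in> hom E (pbo E f g) B" "f \<cdot> pb1 E f g = g \<cdot> pb2 E f g"
    unfolding is_pullback_def pbo_def by simp_all
qed

lemma pb_ex1:
  assumes f: "f \<in> hom E A C" and g: "g \<in> hom E B C"
    and a: "a \<in> hom E Z A" and b: "b \<in> hom E Z B" and eq: "f \<cdot> a = g \<cdot> b"
  shows "\<exists>!u. u \<in> hom E Z (pbo E f g) \<and> pb1 E f g \<cdot> u = a \<and> pb2 E f g \<cdot> u = b"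
proof -
  have "Dom E f = A" "Dom E g = B" using f g homD by blast+
  with is_pullback_pb[OF f g] a b eq show ?thesis unfolding is_pullback_def pbo_def by simp
qed

lemma tup:
  assumes f: "f \<in> hom E A C" and g: "g \<in> hom E B C"
    and a: "a \<in> hom E Z A" and b: "b \<in> hom E Z B" and eq: "f \<cdot> a = g \<cdot> b"
  shows "tup E f g a b \<in> hom E Z (pbo E f g)"
    "pb1 E f g \<cdot> tup E f g a b = a" "pb2 E f g \<cdot> tup E f g a b = b"
  using theI'[OF pb_ex1[OF assms]] a by (auto simp: tup_def hom_def)

lemma tup_unique:
  assumes f: "f \<in> hom E A C" and g: "g \<in> hom E B C"
    and a: "a \<in> hom E Z A" and b: "b \<in> hom E Z B" and eq: "f \<cdot> a = g \<cdot> b"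
    and u: "u \<in> hom E Z (pbo E f g)" "pb1 E f g \<cdot> u = a" "pb2 E f g \<cdot> u = b"
  shows "tup E f g a b = u"
  using pb_ex1[OF f g a b eq] tup[OF f g a b eq] u by blast

lemma tup_Comp:
  assumes f: "f \<in> hom E A C" and g: "g \<in> hom E B C"
    and a: "a \<in> hom E Z A" and b: "b \<in> hom E Z B" and eq: "f \<cdot> a = g \<cdot> b"
    and u: "u \<in> hom E W Z"
  shows "tup E f g a b \<cdot> u = tup E f g (a \<cdot> u) (b \<cdot> u)"
proof (rule tup_unique[symmetric, OF f g])
  note T = tup[OF f g a b eq] and P = pb_hom[OF f g]
  show "a \<cdot> u \<in> hom E W A" "b \<cdot> u \<in> hom E W B" "tup E f g a b \<cdot> u \<in> hom E W (pbo E f g)"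
    using a b u T Comp_hom by blast+
  show "f \<cdot> a \<cdot> u = g \<cdot> b \<cdot> u"
    using Comp_assoc[OF u a f] Comp_assoc[OF u b g] eq by simp
  show "pb1 E f g \<cdot> tup E f g a b \<cdot> u = a \<cdot> u" "pb2 E f g \<cdot> tup E f g a b \<cdot> u = b \<cdot> u"
    using Comp_assoc[OF u T(1) P(1)] Comp_assoc[OF u T(1) P(2)] T by simp_all
qed

lemma icatD:
  assumes "internal_category E C"
  shows "iob C \<in> Ob E" "iarr C \<in> Ob E"
    "isrc C \<in> hom E (iarr C) (iob C)" "itgt C \<in> hom E (iarr C) (iob C)"
    "iunit C \<in> hom E (iob C) (iarr C)"
    "imul C \<in> hom E (pbo E (itgt C) (isrc C)) (iarr C)"
    "isrc C \<cdot> iunit C = Ide E (iob C)" "itgt C \<cdot> iunit C = Ide E (iob C)"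
  using assms unfolding internal_category_def Let_def by blast+

lemma icomp_hom:
  assumes C: "internal_category E C" and a: "a \<in> hom E Z (iarr C)" and b: "b \<in> hom E Z (iarr C)"
    and eq: "itgt C \<cdot> a = isrc C \<cdot> b"
  shows "icomp E C a b \<in> hom E Z (iarr C)"
    "isrc C \<cdot> icomp E C a b = isrc C \<cdot> a" "itgt C \<cdot> icomp E C a b = itgt C \<cdot> b"
proof -
  note D = icatD[OF C]
  note T = tup[OF D(4,3) a b eq] and P = pb_hom[OF D(4,3)]
  show "icomp E C a b \<in> hom E Z (iarr C)" unfolding icomp_def using T(1) D(6) by (rule Comp_hom)
  have e: "isrc C \<cdot> imul C = isrc C \<cdot> pb1 E (itgt C) (isrc C)"
    "itgt C \<cdot> imul C = itgt C \<cdot> pb2 E (itgt C) (isrc C)"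
    using C unfolding internal_category_def Let_def by blast+
  show "isrc C \<cdot> icomp E C a b = isrc C \<cdot> a"
    unfolding icomp_def Comp_assoc[OF T(1) D(6) D(3), symmetric] e Comp_assoc[OF T(1) P(1) D(3)] T ..
  show "itgt C \<cdot> icomp E C a b = itgt C \<cdot> b"
    unfolding icomp_def Comp_assoc[OF T(1) D(6) D(4), symmetric] e Comp_assoc[OF T(1) P(2) D(4)] T ..
qed

lemma icomp_Comp:
  assumes C: "internal_category E C" and a: "a \<in> hom E Z (iarr C)" and b: "b \<in> hom E Z (iarr C)"
    and eq: "itgt C \<cdot> a = isrc C \<cdot> b" and u: "u \<in> hom E W Z"
  shows "icomp E C a b \<cdot> u = icomp E C (a \<cdot> u) (b \<cdot> u)"
proof -
  note D = icatD[OF C]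
  note T = tup[OF D(4,3) a b eq]
  show ?thesis unfolding icomp_def Comp_assoc[OF u T(1) D(6)] tup_Comp[OF D(4,3) a b eq u] ..
qed

lemma icomp_unit_left:
  assumes C: "internal_category E C" and a: "a \<in> hom E Z (iarr C)"
    and x: "isrc C \<cdot> a = x"
  shows "icomp E C (iunit C \<cdot> x) a = a"
proof -
  note D = icatD[OF C]
  have 1: "icomp E C (iunit C \<cdot> isrc C) (Ide E (iarr C)) = Ide E (iarr C)"
    using C unfolding internal_category_def Let_def by blast
  have h: "iunit C \<cdot> isrc C \<in> hom E (iarr C) (iarr C)" "Ide E (iarr C) \<in> hom E (iarr C) (iarr C)"
    using Comp_hom[OF D(3,5)] Ide_hom[OF D(2)] by auto
  have eq: "itgt C \<cdot> iunit C \<cdot> isrc C = isrc C \<cdot> Ide E (iarr C)"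
    using Comp_assoc[OF D(3,5,4)] D(8) Ide_Comp[OF D(3)] Comp_Ide[OF D(3)] by simp
  from icomp_Comp[OF C h eq a] show ?thesis
    unfolding 1 Comp_assoc[OF a D(3,5)] Ide_Comp[OF a] x by simp
qed

lemma icomp_unit_right:
  assumes C: "internal_category E C" and a: "a \<in> hom E Z (iarr C)"
    and x: "itgt C \<cdot> a = x"
  shows "icomp E C a (iunit C \<cdot> x) = a"
proof -
  note D = icatD[OF C]
  have 1: "icomp E C (Ide E (iarr C)) (iunit C \<cdot> itgt C) = Ide E (iarr C)"
    using C unfolding internal_category_def Let_def by blast
  have h: "Ide E (iarr C) \<in> hom E (iarr C) (iarr C)" "iunit C \<cdot> itgt C \<in> hom E (iarr C) (iarr C)"
    using Comp_hom[OF D(4,5)] Ide_hom[OF D(2)] by auto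
  have eq: "itgt C \<cdot> Ide E (iarr C) = isrc C \<cdot> iunit C \<cdot> itgt C"
    using Comp_assoc[OF D(4,5,3)] D(7) Ide_Comp[OF D(4)] Comp_Ide[OF D(4)] by simp
  from icomp_Comp[OF C h eq a] show ?thesis
    unfolding 1 Comp_assoc[OF a D(4,5)] Ide_Comp[OF a] x by simp
qed

lemma icomp_assoc:
  assumes C: "internal_category E C" and a: "a \<in> hom E Z (iarr C)" and b: "b \<in> hom E Z (iarr C)"
    and c: "c \<in> hom E Z (iarr C)"
    and eq: "itgt C \<cdot> a = isrc C \<cdot> b" "itgt C \<cdot> b = isrc C \<cdot> c"
  shows "icomp E C (icomp E C a b) c = icomp E C a (icomp E C b c)"
proof -
  note D = icatD[OF C]
  define p where "p = pb1 E (itgt C) (isrc C)"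
  define q where "q = pb2 E (itgt C) (isrc C)"
  define r1 where "r1 = pb1 E q p"
  define r2 where "r2 = pb2 E q p"
  note P = pb_hom[OF D(4,3), folded p_def q_def]
  note R = pb_hom[OF P(2,1), folded r1_def r2_def]
  have m: "isrc C \<cdot> imul C = isrc C \<cdot> p" "itgt C \<cdot> imul C = itgt C \<cdot> q"
    "icomp E C (imul C \<cdot> r1) (q \<cdot> r2) = icomp E C (p \<cdot> r1) (imul C \<cdot> r2)"
    using C unfolding internal_category_def Let_def p_def q_def r1_def r2_def by blast+
  define x where "x = tup E (itgt C) (isrc C) a b"
  define y where "y = tup E (itgt C) (isrc C) b c"
  note X = tup[OF D(4,3) a b eq(1), folded x_def p_def q_def]
  note Y = tup[OF D(4,3) b c eq(2), folded y_def p_def q_def]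
  define w where "w = tup E q p x y"
  have "q \<cdot> x = p \<cdot> y" using X Y by simp
  note W = tup[OF P(2,1) X(1) Y(1) this, folded w_def r1_def r2_def]
  have e1: "icomp E C (imul C \<cdot> r1) (q \<cdot> r2) \<cdot> w = icomp E C (icomp E C a b) c"
  proof -
    have "itgt C \<cdot> imul C \<cdot> r1 = isrc C \<cdot> q \<cdot> r2"
      using Comp_assoc[OF R(1) D(6,4)] m Comp_assoc[OF R(1) P(2) D(4)]
        R(3) Comp_assoc[OF R(2) P(1) D(4)] Comp_assoc[OF R(2) P(2) D(3)] P(3) by simp
    from icomp_Comp[OF C Comp_hom[OF R(1) D(6)] Comp_hom[OF R(2) P(2)] this W(1)]
    show ?thesis
      using Comp_assoc[OF W(1) R(1) D(6)] Comp_assoc[OF W(1) R(2) P(2)] W Y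
      by (simp add: icomp_def x_def)
  qed
  have e2: "icomp E C (p \<cdot> r1) (imul C \<cdot> r2) \<cdot> w = icomp E C a (icomp E C b c)"
  proof -
    have "itgt C \<cdot> p \<cdot> r1 = isrc C \<cdot> imul C \<cdot> r2"
      using Comp_assoc[OF R(2) D(6,3)] m Comp_assoc[OF R(2) P(1) D(3)]
        R(3) Comp_assoc[OF R(1) P(1) D(4)] Comp_assoc[OF R(1) P(2) D(3)] P(3) by simp
    from icomp_Comp[OF C Comp_hom[OF R(1) P(1)] Comp_hom[OF R(2) D(6)] this W(1)]
    show ?thesis
      using Comp_assoc[OF W(1) R(1) P(1)] Comp_assoc[OF W(1) R(2) D(6)] W X
      by (simp add: icomp_def y_def)
  qed
  show ?thesis using e1 e2 m(3) by simp
qed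

lemma ifunD:
  assumes "internal_functor E F" "fdom F = A" "fcod F = B"
  shows "internal_category E A" "internal_category E B"
    "fob F \<in> hom E (iob A) (iob B)" "farr F \<in> hom E (iarr A) (iarr B)"
    "isrc B \<cdot> farr F = fob F \<cdot> isrc A" "itgt B \<cdot> farr F = fob F \<cdot> itgt A"
    "farr F \<cdot> iunit A = iunit B \<cdot> fob F"
  using assms unfolding internal_functor_def Let_def by blast+

lemma ifun_src:
  assumes "internal_functor E F" "fdom F = A" "fcod F = B" "x \<in> hom E Z (iarr A)"
  shows "isrc B \<cdot> farr F \<cdot> x = fob F \<cdot> isrc A \<cdot> x" "itgt B \<cdot> farr F \<cdot> x = fob F \<cdot> itgt A \<cdot> x"
proof -
  note F = ifunD[OF assms(1-3)] and x = assms(4)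
  note A = icatD[OF F(1)] and B = icatD[OF F(2)]
  show "isrc B \<cdot> farr F \<cdot> x = fob F \<cdot> isrc A \<cdot> x"
    using Comp_assoc[OF x F(4) B(3)] Comp_assoc[OF x A(3) F(3)] F(5) by simp
  show "itgt B \<cdot> farr F \<cdot> x = fob F \<cdot> itgt A \<cdot> x"
    using Comp_assoc[OF x F(4) B(4)] Comp_assoc[OF x A(4) F(3)] F(6) by simp
qed

lemma ifun_icomp:
  assumes "internal_functor E F" "fdom F = A" "fcod F = B"
    and a: "a \<in> hom E Z (iarr A)" and b: "b \<in> hom E Z (iarr A)"
    and eq: "itgt A \<cdot> a = isrc A \<cdot> b"
  shows "farr F \<cdot> icomp E A a b = icomp E B (farr F \<cdot> a) (farr F \<cdot> b)"
proof -
  note F = ifunD[OF assms(1-3)]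
  note A = icatD[OF F(1)] and B = icatD[OF F(2)]
  define p where "p = pb1 E (itgt A) (isrc A)"
  define q where "q = pb2 E (itgt A) (isrc A)"
  define u where "u = tup E (itgt A) (isrc A) a b"
  note P = pb_hom[OF A(4,3), folded p_def q_def]
  note U = tup[OF A(4,3) a b eq, folded u_def p_def q_def]
  have m: "farr F \<cdot> imul A = icomp E B (farr F \<cdot> p) (farr F \<cdot> q)"
    using assms(1-3) unfolding internal_functor_def Let_def p_def q_def by blast
  have "itgt B \<cdot> farr F \<cdot> p = isrc B \<cdot> farr F \<cdot> q"
    using ifun_src[OF assms(1-3)] P by simp
  from icomp_Comp[OF F(2) Comp_hom[OF P(1) F(4)] Comp_hom[OF P(2) F(4)] this U(1)]
  show ?thesis
    using Comp_assoc[OF U(1) P(1) F(4)] Comp_assoc[OF U(1) P(2) F(4)] U m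
      Comp_assoc[OF U(1) A(6) F(4)] by (simp add: icomp_def[of E A] u_def)
qed

lemma ifunI:
  assumes C: "internal_category E A" "internal_category E B"
    and h: "fob F \<in> hom E (iob A) (iob B)" "farr F \<in> hom E (iarr A) (iarr B)"
    and s: "isrc B \<cdot> farr F = fob F \<cdot> isrc A" "itgt B \<cdot> farr F = fob F \<cdot> itgt A"
      "farr F \<cdot> iunit A = iunit B \<cdot> fob F"
    and m: "\<And>Z a b. a \<in> hom E Z (iarr A) \<Longrightarrow> b \<in> hom E Z (iarr A) \<Longrightarrow> itgt A \<cdot> a = isrc A \<cdot> b
      \<Longrightarrow> farr F \<cdot> icomp E A a b = icomp E B (farr F \<cdot> a) (farr F \<cdot> b)"
    and d: "fdom F = A" "fcod F = B"
  shows "internal_functor E F"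
proof -
  note A = icatD[OF C(1)]
  note P = pb_hom[OF A(4,3)]
  have "Ide E (pbo E (itgt A) (isrc A)) \<in> hom E (pbo E (itgt A) (isrc A)) (pbo E (itgt A) (isrc A))"
    using Ide_hom hom_Ob P(1) by blast
  then have "tup E (itgt A) (isrc A) (pb1 E (itgt A) (isrc A)) (pb2 E (itgt A) (isrc A))
      = Ide E (pbo E (itgt A) (isrc A))"
    using P Comp_Ide by (intro tup_unique[OF A(4,3)]) auto
  then have "icomp E A (pb1 E (itgt A) (isrc A)) (pb2 E (itgt A) (isrc A)) = imul A"
    unfolding icomp_def using Comp_Ide[OF A(6)] by simp
  then show ?thesis
    using assms m[OF P] unfolding internal_functor_def Let_def by simp
qed

lemma inatD:
  assumes "internal_nat E \<alpha>" "ndom \<alpha> = F" "ncod \<alpha> = G" "fdom F = A" "fcod F = B"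
  shows "internal_functor E F" "internal_functor E G" "fdom G = A" "fcod G = B"
    "ncomp \<alpha> \<in> hom E (iob A) (iarr B)" "isrc B \<cdot> ncomp \<alpha> = fob F" "itgt B \<cdot> ncomp \<alpha> = fob G"
    "icomp E B (ncomp \<alpha> \<cdot> isrc A) (farr G) = icomp E B (farr F) (ncomp \<alpha> \<cdot> itgt A)"
  using assms unfolding internal_nat_def Let_def by blast+

lemma inat_src:
  assumes "internal_nat E \<alpha>" "ndom \<alpha> = F" "ncod \<alpha> = G" "fdom F = A" "fcod F = B"
    and x: "x \<in> hom E Z (iob A)"
  shows "ncomp \<alpha> \<cdot> x \<in> hom E Z (iarr B)"
    "isrc B \<cdot> ncomp \<alpha> \<cdot> x = fob F \<cdot> x" "itgt B \<cdot> ncomp \<alpha> \<cdot> x = fob G \<cdot> x"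
proof -
  note N = inatD[OF assms(1-5)]
  note B = icatD[OF ifunD(2)[OF N(1) assms(4,5)]]
  show "ncomp \<alpha> \<cdot> x \<in> hom E Z (iarr B)" using x N(5) by (rule Comp_hom)
  show "isrc B \<cdot> ncomp \<alpha> \<cdot> x = fob F \<cdot> x" "itgt B \<cdot> ncomp \<alpha> \<cdot> x = fob G \<cdot> x"
    using Comp_assoc[OF x N(5) B(3)] Comp_assoc[OF x N(5) B(4)] N by simp_all
qed

lemma inat_natural:
  assumes "internal_nat E \<alpha>" "ndom \<alpha> = F" "ncod \<alpha> = G" "fdom F = A" "fcod F = B"
    and x: "x \<in> hom E Z (iarr A)"
  shows "icomp E B (ncomp \<alpha> \<cdot> isrc A \<cdot> x) (farr G \<cdot> x) = icomp E B (farr F \<cdot> x) (ncomp \<alpha> \<cdot> itgt A \<cdot> x)"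
proof -
  note N = inatD[OF assms(1-5)]
  note F = ifunD[OF N(1) assms(4,5)] and G = ifunD[OF N(2,3,4)]
  note A = icatD[OF F(1)] and B = icatD[OF F(2)]
  note S = inat_src[OF assms(1-5)]
  have "itgt B \<cdot> ncomp \<alpha> \<cdot> isrc A = isrc B \<cdot> farr G" using S A(3) G by simp
  note 1 = icomp_Comp[OF F(2) Comp_hom[OF A(3) N(5)] G(4) this x]
  have "itgt B \<cdot> farr F = isrc B \<cdot> ncomp \<alpha> \<cdot> itgt A" using S A(4) F by simp
  note 2 = icomp_Comp[OF F(2) F(4) Comp_hom[OF A(4) N(5)] this x]
  show ?thesis using 1 2 Comp_assoc[OF x A(3) N(5)] Comp_assoc[OF x A(4) N(5)] N(8) by simp
qed

lemma Cat_simps: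
  "Ob (Cat E) = {C. internal_category E C}" "Ar (Cat E) = {F. internal_functor E F}"
  "Dom (Cat E) = fdom" "Cod (Cat E) = fcod"
  "Ide (Cat E) A = \<lparr>fdom = A, fcod = A, fob = Ide E (iob A), farr = Ide E (iarr A)\<rparr>"
  "G \<cdot>\<^bsub>Cat E\<^esub> F = \<lparr>fdom = fdom F, fcod = fcod G, fob = fob G \<cdot> fob F, farr = farr G \<cdot> farr F\<rparr>"
  "Cell (Cat E) = {\<alpha>. internal_nat E \<alpha>}" "CDom (Cat E) = ndom" "CCod (Cat E) = ncod"
  "CIde (Cat E) F = \<lparr>ndom = F, ncod = F, ncomp = iunit (fcod F) \<cdot> fob F\<rparr>"
  "\<beta> \<bullet>\<^bsub>Cat E\<^esub> \<alpha> = \<lparr>ndom = ndom \<alpha>, ncod = ncod \<beta>,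
    ncomp = icomp E (fcod (ndom \<alpha>)) (ncomp \<alpha>) (ncomp \<beta>)\<rparr>"
  "\<beta> \<star>\<^bsub>Cat E\<^esub> \<alpha> = \<lparr>ndom = ndom \<beta> \<cdot>\<^bsub>Cat E\<^esub> ndom \<alpha>, ncod = ncod \<beta> \<cdot>\<^bsub>Cat E\<^esub> ncod \<alpha>,
    ncomp = icomp E (fcod (ndom \<beta>)) (farr (ndom \<beta>) \<cdot> ncomp \<alpha>) (ncomp \<beta> \<cdot> fob (ncod \<alpha>))\<rparr>"
  by (simp_all add: Cat_def)

lemma hom_Cat: "F \<in> hom (Cat E) A B \<longleftrightarrow> internal_functor E F \<and> fdom F = A \<and> fcod F = B"
  by (simp add: hom_def Cat_simps)

lemma cells_Cat: "\<alpha> \<in> cells (Cat E) F G \<longleftrightarrow> internal_nat E \<alpha> \<and> ndom \<alpha> = F \<and> ncod \<alpha> = G"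
  by (simp add: cells_def Cat_simps)

lemma Ide_ifun:
  assumes "internal_category E A"
  shows "internal_functor E (Ide (Cat E) A)"
proof -
  note A = icatD[OF assms]
  note I = Ide_hom[OF A(1)] Ide_hom[OF A(2)]
  show ?thesis
  proof (rule ifunI[of A A])
    fix Z a b assume ab: "a \<in> hom E Z (iarr A)" "b \<in> hom E Z (iarr A)" "itgt A \<cdot> a = isrc A \<cdot> b"
    show "farr (Ide (Cat E) A) \<cdot> icomp E A a b =
        icomp E A (farr (Ide (Cat E) A) \<cdot> a) (farr (Ide (Cat E) A) \<cdot> b)"
      using Ide_Comp[OF icomp_hom(1)[OF assms ab]] Ide_Comp[OF ab(1)] Ide_Comp[OF ab(2)]
      by (simp add: Cat_simps)
  qed (use assms A I Comp_Ide Ide_Comp in \<open>simp_all add: Cat_simps\<close>)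
qed

lemma Comp_ifun:
  assumes "internal_functor E F" "internal_functor E G" "fcod F = fdom G"
  shows "internal_functor E (G \<cdot>\<^bsub>Cat E\<^esub> F)"
proof -
  note F = ifunD[OF assms(1) refl refl] and G = ifunD[OF assms(2) assms(3)[symmetric] refl]
  note A = icatD[OF F(1)] and B = icatD[OF F(2)] and C = icatD[OF G(2)]
  show ?thesis
  proof (rule ifunI[OF F(1) G(2)])
    fix Z a b assume ab: "a \<in> hom E Z (iarr (fdom F))" "b \<in> hom E Z (iarr (fdom F))"
      and eq: "itgt (fdom F) \<cdot> a = isrc (fdom F) \<cdot> b"
    have 1: "itgt (fcod F) \<cdot> farr F \<cdot> a = isrc (fcod F) \<cdot> farr F \<cdot> b"
      using ifun_src[OF assms(1) refl refl] ab eq by simp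
    show "farr (G \<cdot>\<^bsub>Cat E\<^esub> F) \<cdot> icomp E (fdom F) a b =
        icomp E (fcod G) (farr (G \<cdot>\<^bsub>Cat E\<^esub> F) \<cdot> a) (farr (G \<cdot>\<^bsub>Cat E\<^esub> F) \<cdot> b)"
      using Comp_assoc[OF ab(1) F(4) G(4)] Comp_assoc[OF ab(2) F(4) G(4)]
        Comp_assoc[OF icomp_hom(1)[OF F(1) ab eq] F(4) G(4)]
        ifun_icomp[OF assms(1) refl refl ab eq]
        ifun_icomp[OF assms(2) assms(3)[symmetric] refl Comp_hom[OF ab(1) F(4)] Comp_hom[OF ab(2) F(4)] 1]
      by (simp add: Cat_simps)
  qed (use F G Comp_hom[OF F(3) G(3)] Comp_hom[OF F(4) G(4)]
      ifun_src[OF assms(2) assms(3)[symmetric] refl F(4)]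
      Comp_assoc[OF A(3) F(3) G(3)] Comp_assoc[OF A(4) F(3) G(3)] Comp_assoc[OF A(5) F(4) G(4)]
      Comp_assoc[OF F(3) B(5) G(4)] Comp_assoc[OF F(3) G(3) C(5)]
      in \<open>simp_all add: Cat_simps\<close>)
qed

lemma category_Cat: "category (Cat E)"
proof
  fix F assume "F \<in> Ar (Cat E)"
  then show "Dom (Cat E) F \<in> Ob (Cat E)" "Cod (Cat E) F \<in> Ob (Cat E)"
    using ifunD(1,2)[OF _ refl refl] by (auto simp: Cat_simps)
next
  fix A assume "A \<in> Ob (Cat E)"
  then show "Ide (Cat E) A \<in> hom (Cat E) A A" using Ide_ifun by (simp add: hom_Cat) (simp add: Cat_simps)
next
  fix F G A B C assume "F \<in> hom (Cat E) A B" "G \<in> hom (Cat E) B C"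
  then show "G \<cdot>\<^bsub>Cat E\<^esub> F \<in> hom (Cat E) A C" using Comp_ifun by (simp add: hom_Cat) (simp add: Cat_simps)
next
  fix F A B assume "F \<in> hom (Cat E) A B"
  then show "F \<cdot>\<^bsub>Cat E\<^esub> Ide (Cat E) A = F" "Ide (Cat E) B \<cdot>\<^bsub>Cat E\<^esub> F = F"
    using ifunD(3,4)[of F A B] Comp_Ide Ide_Comp by (auto simp: hom_Cat Cat_simps)
next
  fix F G H A B C D assume "F \<in> hom (Cat E) A B" "G \<in> hom (Cat E) B C" "H \<in> hom (Cat E) C D"
  then show "(H \<cdot>\<^bsub>Cat E\<^esub> G) \<cdot>\<^bsub>Cat E\<^esub> F = H \<cdot>\<^bsub>Cat E\<^esub> (G \<cdot>\<^bsub>Cat E\<^esub> F)"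
    using ifunD(3,4)[of F A B] ifunD(3,4)[of G B C] ifunD(3,4)[of H C D] Comp_assoc
    by (auto simp: hom_Cat Cat_simps)
qed

lemma inatI:
  assumes F: "internal_functor E F" "internal_functor E G" "fdom F = A" "fcod F = B"
      "fdom G = A" "fcod G = B"
    and a: "ncomp \<alpha> \<in> hom E (iob A) (iarr B)"
      "isrc B \<cdot> ncomp \<alpha> = fob F" "itgt B \<cdot> ncomp \<alpha> = fob G"
      "icomp E B (ncomp \<alpha> \<cdot> isrc A) (farr G) = icomp E B (farr F) (ncomp \<alpha> \<cdot> itgt A)"
    and d: "ndom \<alpha> = F" "ncod \<alpha> = G"
  shows "internal_nat E \<alpha>"
  using assms unfolding internal_nat_def Let_def by simp

lemma CIde_inat:
  assumes F: "internal_functor E F"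
  shows "internal_nat E (CIde (Cat E) F)"
proof -
  note F' = ifunD[OF F refl refl]
  note A = icatD[OF F'(1)] and B = icatD[OF F'(2)]
  show ?thesis
    by (rule inatI[OF F F refl refl refl refl])
     (use F' Comp_hom[OF F'(3) B(5)] Comp_assoc[OF F'(3) B(5,3)] Comp_assoc[OF F'(3) B(5,4)]
      B Ide_Comp[OF F'(3)] Comp_assoc[OF A(3) F'(3) B(5)] Comp_assoc[OF A(4) F'(3) B(5)]
      icomp_unit_left[OF F'(2,4,5)] icomp_unit_right[OF F'(2,4,6)]
      in \<open>simp_all add: Cat_simps\<close>)
qed

lemma VComp_inat:
  assumes a: "internal_nat E \<alpha>" and b: "internal_nat E \<beta>" and eq: "ncod \<alpha> = ndom \<beta>"
  shows "internal_nat E (\<beta> \<bullet>\<^bsub>Cat E\<^esub> \<alpha>)"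
proof -
  define F where "F = ndom \<alpha>"
  define A where "A = fdom F"
  define B where "B = fcod F"
  define G where "G = ncod \<alpha>"
  define H where "H = ncod \<beta>"
  note d = F_def[symmetric] A_def[symmetric] B_def[symmetric] G_def[symmetric] H_def[symmetric]
  have e: "ndom \<beta> = G" using eq G_def by simp
  note N = inatD[OF a d(1,4,2,3)]
  note N' = inatD[OF b e d(5) N(3,4)]
  note F = ifunD[OF N(1) d(2,3)] and G = ifunD[OF N(2,3,4)] and H = ifunD[OF N'(2,3,4)]
  note A = icatD[OF F(1)] and B = icatD[OF F(2)]
  note na = inat_src[OF a d(1,4,2,3)] and nb = inat_src[OF b e d(5) N(3,4)]
  note C = F(2)
  have m: "itgt B \<cdot> ncomp \<alpha> = isrc B \<cdot> ncomp \<beta>" using N N' by simp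
  note hm = icomp_hom[OF C N(5) N'(5) m]
  show ?thesis
  proof (rule inatI[OF N(1) N'(2) d(2,3) N'(3,4)])
    have "icomp E B (icomp E B (ncomp \<alpha>) (ncomp \<beta>) \<cdot> isrc A) (farr H)
        = icomp E B (icomp E B (ncomp \<alpha> \<cdot> isrc A) (ncomp \<beta> \<cdot> isrc A)) (farr H)"
      using icomp_Comp[OF C N(5) N'(5) m A(3)] by simp
    also have "\<dots> = icomp E B (ncomp \<alpha> \<cdot> isrc A) (icomp E B (ncomp \<beta> \<cdot> isrc A) (farr H))"
      using na[OF A(3)] nb[OF A(3)] H by (intro icomp_assoc[OF C]) simp_all
    also have "\<dots> = icomp E B (ncomp \<alpha> \<cdot> isrc A) (icomp E B (farr G) (ncomp \<beta> \<cdot> itgt A))"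
      using N'(8) by simp
    also have "\<dots> = icomp E B (icomp E B (ncomp \<alpha> \<cdot> isrc A) (farr G)) (ncomp \<beta> \<cdot> itgt A)"
      using na[OF A(3)] nb[OF A(4)] G by (intro icomp_assoc[OF C, symmetric]) simp_all
    also have "\<dots> = icomp E B (icomp E B (farr F) (ncomp \<alpha> \<cdot> itgt A)) (ncomp \<beta> \<cdot> itgt A)"
      using N(8) by simp
    also have "\<dots> = icomp E B (farr F) (icomp E B (ncomp \<alpha> \<cdot> itgt A) (ncomp \<beta> \<cdot> itgt A))"
      using na[OF A(4)] nb[OF A(4)] F by (intro icomp_assoc[OF C]) simp_all
    also have "\<dots> = icomp E B (farr F) (icomp E B (ncomp \<alpha>) (ncomp \<beta>) \<cdot> itgt A)"
      using icomp_Comp[OF C N(5) N'(5) m A(4)] by simp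
    finally show "icomp E B (ncomp (\<beta> \<bullet>\<^bsub>Cat E\<^esub> \<alpha>) \<cdot> isrc A) (farr H)
        = icomp E B (farr F) (ncomp (\<beta> \<bullet>\<^bsub>Cat E\<^esub> \<alpha>) \<cdot> itgt A)"
      using d by (simp add: Cat_simps)
  qed (use hm N N' d in \<open>simp_all add: Cat_simps\<close>)
qed

lemma HComp_arr:
  assumes a: "internal_nat E \<alpha>" and b: "internal_nat E \<beta>" and eq: "fcod (ndom \<alpha>) = fdom (ndom \<beta>)"
  shows "icomp E (fcod (ndom \<beta>)) (ncomp \<beta> \<cdot> fob (ndom \<alpha>)) (farr (ncod \<beta>) \<cdot> ncomp \<alpha>)
    = icomp E (fcod (ndom \<beta>)) (farr (ndom \<beta>) \<cdot> ncomp \<alpha>) (ncomp \<beta> \<cdot> fob (ncod \<alpha>))"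
  using inat_natural[OF b refl refl refl refl, of "ncomp \<alpha>"] inatD[OF a refl refl refl refl] eq by simp

lemma HComp_inat:
  assumes a: "internal_nat E \<alpha>" and b: "internal_nat E \<beta>" and eq: "fcod (ndom \<alpha>) = fdom (ndom \<beta>)"
  shows "internal_nat E (\<beta> \<star>\<^bsub>Cat E\<^esub> \<alpha>)"
proof -
  define F where "F = ndom \<alpha>"
  define A where "A = fdom F"
  define B where "B = fcod F"
  define G where "G = ncod \<alpha>"
  define H where "H = ndom \<beta>"
  define C where "C = fcod H"
  define K where "K = ncod \<beta>"
  note d = F_def[symmetric] A_def[symmetric] B_def[symmetric] G_def[symmetric] H_def[symmetric]
    C_def[symmetric] K_def[symmetric]
  have e: "fdom H = B" using eq F_def B_def H_def by simp
  note N = inatD[OF a d(1,4,2,3)] and N' = inatD[OF b d(5,7) e d(6)]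
  note F = ifunD[OF N(1) d(2,3)] and G = ifunD[OF N(2,3,4)]
    and H = ifunD[OF N'(1) e d(6)] and K = ifunD[OF N'(2,3,4)]
  note A = icatD[OF F(1)] and B = icatD[OF F(2)] and C = icatD[OF H(2)]
  note na = inat_src[OF a d(1,4,2,3)] and nb = inat_src[OF b d(5,7) e d(6)]
  note fH = ifun_src[OF N'(1) e d(6)] and fK = ifun_src[OF N'(2,3,4)]
  have h: "farr H \<cdot> ncomp \<alpha> \<in> hom E (iob A) (iarr C)" using Comp_hom[OF N(5) H(4)] .
  have m: "itgt C \<cdot> farr H \<cdot> ncomp \<alpha> = isrc C \<cdot> ncomp \<beta> \<cdot> fob G"
    using fH[OF N(5)] N(7) nb[OF G(3)] by simp
  note hm = icomp_hom[OF H(2) h nb(1)[OF G(3)] m]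
  define \<eta> where "\<eta> = icomp E C (farr H \<cdot> ncomp \<alpha>) (ncomp \<beta> \<cdot> fob G)"
  have hx: "farr H \<cdot> x \<in> hom E Z (iarr C)" "farr K \<cdot> x \<in> hom E Z (iarr C)" if "x \<in> hom E Z (iarr B)" for x Z
    using that H(4) K(4) Comp_hom by blast+
  have fx: "fob F \<cdot> x \<in> hom E Z (iob B)" "fob G \<cdot> x \<in> hom E Z (iob B)" if "x \<in> hom E Z (iob A)" for x Z
    using that F(3) G(3) Comp_hom by blast+
  have \<eta>: "\<eta> \<cdot> x = icomp E C (farr H \<cdot> ncomp \<alpha> \<cdot> x) (ncomp \<beta> \<cdot> fob G \<cdot> x)"
    if x: "x \<in> hom E Z (iob A)" for x Z
    unfolding \<eta>_def icomp_Comp[OF H(2) h nb(1)[OF G(3)] m x]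
      Comp_assoc[OF x N(5) H(4)] Comp_assoc[OF x G(3) N'(5)] ..
  show ?thesis
  proof (rule inatI)
    show "internal_functor E (H \<cdot>\<^bsub>Cat E\<^esub> F)" using Comp_ifun[OF N(1) N'(1)] e B_def by simp
    show "internal_functor E (K \<cdot>\<^bsub>Cat E\<^esub> G)" using Comp_ifun[OF N(2) N'(2)] N N' by simp
    have "icomp E C (\<eta> \<cdot> isrc A) (farr K \<cdot> farr G)
      = icomp E C (icomp E C (farr H \<cdot> ncomp \<alpha> \<cdot> isrc A) (ncomp \<beta> \<cdot> fob G \<cdot> isrc A)) (farr K \<cdot> farr G)"
      using \<eta>[OF A(3)] by simp
    also have "\<dots> = icomp E C (farr H \<cdot> ncomp \<alpha> \<cdot> isrc A) (icomp E C (ncomp \<beta> \<cdot> fob G \<cdot> isrc A) (farr K \<cdot> farr G))"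
      using hx[OF na(1)[OF A(3)]] nb[OF fx(2)[OF A(3)]] hx[OF G(4)] fH[OF na(1)[OF A(3)]] na[OF A(3)]
        fK[OF G(4)] G
      by (intro icomp_assoc[OF H(2)]) simp_all
    also have "icomp E C (ncomp \<beta> \<cdot> fob G \<cdot> isrc A) (farr K \<cdot> farr G) =
        icomp E C (farr H \<cdot> farr G) (ncomp \<beta> \<cdot> fob G \<cdot> itgt A)"
      using inat_natural[OF b d(5,7) e d(6) G(4)] G by simp
    also have "icomp E C (farr H \<cdot> ncomp \<alpha> \<cdot> isrc A) (icomp E C (farr H \<cdot> farr G) (ncomp \<beta> \<cdot> fob G \<cdot> itgt A))
      = icomp E C (icomp E C (farr H \<cdot> ncomp \<alpha> \<cdot> isrc A) (farr H \<cdot> farr G)) (ncomp \<beta> \<cdot> fob G \<cdot> itgt A)"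
      using hx[OF na(1)[OF A(3)]] nb[OF fx(2)[OF A(4)]] hx[OF G(4)] fH[OF na(1)[OF A(3)]] na[OF A(3)]
        fH[OF G(4)] G
      by (intro icomp_assoc[OF H(2), symmetric]) simp_all
    also have "icomp E C (farr H \<cdot> ncomp \<alpha> \<cdot> isrc A) (farr H \<cdot> farr G) =
        farr H \<cdot> icomp E B (ncomp \<alpha> \<cdot> isrc A) (farr G)"
      using na[OF A(3)] G by (intro ifun_icomp[OF N'(1) e d(6), symmetric]) simp_all
    also have "icomp E B (ncomp \<alpha> \<cdot> isrc A) (farr G) = icomp E B (farr F) (ncomp \<alpha> \<cdot> itgt A)"
      by (rule N(8))
    also have "farr H \<cdot> \<dots> = icomp E C (farr H \<cdot> farr F) (farr H \<cdot> ncomp \<alpha> \<cdot> itgt A)"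
      using na[OF A(4)] F by (intro ifun_icomp[OF N'(1) e d(6)]) simp_all
    also have "icomp E C \<dots> (ncomp \<beta> \<cdot> fob G \<cdot> itgt A) =
        icomp E C (farr H \<cdot> farr F) (icomp E C (farr H \<cdot> ncomp \<alpha> \<cdot> itgt A) (ncomp \<beta> \<cdot> fob G \<cdot> itgt A))"
      using hx[OF na(1)[OF A(4)]] nb[OF fx(2)[OF A(4)]] hx[OF F(4)] fH[OF na(1)[OF A(4)]] na[OF A(4)]
        fH[OF F(4)] F
      by (intro icomp_assoc[OF H(2)]) simp_all
    also have "\<dots> = icomp E C (farr H \<cdot> farr F) (\<eta> \<cdot> itgt A)" using \<eta>[OF A(4)] by simp
    finally show "icomp E C (ncomp (\<beta> \<star>\<^bsub>Cat E\<^esub> \<alpha>) \<cdot> isrc A) (farr (K \<cdot>\<^bsub>Cat E\<^esub> G))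
        = icomp E C (farr (H \<cdot>\<^bsub>Cat E\<^esub> F)) (ncomp (\<beta> \<star>\<^bsub>Cat E\<^esub> \<alpha>) \<cdot> itgt A)"
      using d by (simp add: Cat_simps \<eta>_def)
  qed (use hm d N N' nb(3)[OF G(3)] fH(1)[OF N(5)] in \<open>simp_all add: Cat_simps\<close>)
qed

lemma two_category_Cat: "two_category (Cat E)"
proof (intro two_category.intro two_category_axioms.intro category_Cat)
  let ?K = "Cat E"
  interpret K: category ?K by (rule category_Cat)
  fix \<alpha> assume "\<alpha> \<in> Cell ?K"
  then have a: "internal_nat E \<alpha>" by (simp add: Cat_simps)
  note N = inatD[OF a refl refl refl refl]
  show "CDom ?K \<alpha> \<in> Ar ?K" "CCod ?K \<alpha> \<in> hom ?K (Dom ?K (CDom ?K \<alpha>)) (Cod ?K (CDom ?K \<alpha>))"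
    using N by (simp_all add: Cat_simps hom_def)
next
  let ?K = "Cat E"
  fix F assume "F \<in> Ar ?K"
  then show "CIde ?K F \<in> cells ?K F F"
    using CIde_inat by (simp add: cells_Cat) (simp add: Cat_simps)
next
  let ?K = "Cat E"
  fix F G H \<alpha> \<beta> assume "\<alpha> \<in> cells ?K F G" "\<beta> \<in> cells ?K G H"
  then show "\<beta> \<bullet>\<^bsub>?K\<^esub> \<alpha> \<in> cells ?K F H"
    using VComp_inat by (simp add: cells_Cat) (simp add: Cat_simps)
next
  let ?K = "Cat E"
  fix F G \<alpha> assume "\<alpha> \<in> cells ?K F G"
  then have a: "internal_nat E \<alpha>" "ndom \<alpha> = F" "ncod \<alpha> = G" by (simp_all add: cells_Cat)
  note N = inatD[OF a refl refl]
  note F = ifunD[OF N(1) refl refl] and G = ifunD[OF N(2,3,4)]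
  show "\<alpha> \<bullet>\<^bsub>?K\<^esub> CIde ?K F = \<alpha>" "CIde ?K G \<bullet>\<^bsub>?K\<^esub> \<alpha> = \<alpha>"
    using a N icomp_unit_left[OF F(2) N(5,6)] icomp_unit_right[OF F(2) N(5,7)]
    by (simp_all add: Cat_simps)
  note A = icatD[OF F(1)] and B = icatD[OF F(2)]
  have "icomp E (fcod F) (Ide E (iarr (fcod F)) \<cdot> ncomp \<alpha>)
      ((iunit (fcod F) \<cdot> Ide E (iob (fcod F))) \<cdot> fob G) = ncomp \<alpha>"
    using Ide_Comp[OF N(5)] Comp_Ide[OF B(5)] icomp_unit_right[OF F(2) N(5,7)] by simp
  then show "CIde ?K (Ide ?K (Cod ?K F)) \<star>\<^bsub>?K\<^esub> \<alpha> = \<alpha>"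
    using a N Ide_Comp[OF F(3)] Ide_Comp[OF F(4)] Ide_Comp[OF G(3)] Ide_Comp[OF G(4)]
    by (simp add: Cat_simps)
  have "icomp E (fcod F) (farr F \<cdot> iunit (fdom F) \<cdot> Ide E (iob (fdom F)))
      (ncomp \<alpha> \<cdot> Ide E (iob (fdom F))) = ncomp \<alpha>"
    using Comp_Ide[OF N(5)] Comp_Ide[OF A(5)] F(7) icomp_unit_left[OF F(2) N(5,6)] by simp
  then show "\<alpha> \<star>\<^bsub>?K\<^esub> CIde ?K (Ide ?K (Dom ?K F)) = \<alpha>"
    using a N Comp_Ide[OF F(3)] Comp_Ide[OF F(4)] Comp_Ide[OF G(3)] Comp_Ide[OF G(4)]
    by (simp add: Cat_simps)
next
  let ?K = "Cat E"
  fix F G H L \<alpha> \<beta> \<gamma>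
  assume "\<alpha> \<in> cells ?K F G" "\<beta> \<in> cells ?K G H" "\<gamma> \<in> cells ?K H L"
  then have a: "internal_nat E \<alpha>" "ndom \<alpha> = F" "ncod \<alpha> = G"
    and b: "internal_nat E \<beta>" "ndom \<beta> = G" "ncod \<beta> = H"
    and c: "internal_nat E \<gamma>" "ndom \<gamma> = H" "ncod \<gamma> = L" by (simp_all add: cells_Cat)
  note N = inatD[OF a refl refl]
  note N' = inatD[OF b N(3,4)]
  note N'' = inatD[OF c N'(3,4)]
  note F = ifunD[OF N(1) refl refl]
  show "(\<gamma> \<bullet>\<^bsub>?K\<^esub> \<beta>) \<bullet>\<^bsub>?K\<^esub> \<alpha> = \<gamma> \<bullet>\<^bsub>?K\<^esub> (\<beta> \<bullet>\<^bsub>?K\<^esub> \<alpha>)"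
    using a b c N N' N'' icomp_assoc[OF F(2) N(5) N'(5) N''(5)] by (simp add: Cat_simps)
next
  let ?K = "Cat E"
  fix F G \<alpha> H L \<beta>
  assume "\<alpha> \<in> cells ?K F G" "\<beta> \<in> cells ?K H L" "Cod ?K F = Dom ?K H"
  then show "\<beta> \<star>\<^bsub>?K\<^esub> \<alpha> \<in> cells ?K (H \<cdot>\<^bsub>?K\<^esub> F) (L \<cdot>\<^bsub>?K\<^esub> G)"
    using HComp_inat[of \<alpha> \<beta>] by (simp add: cells_Cat) (simp add: Cat_simps)
next
  let ?K = "Cat E"
  fix F F' \<alpha> G G' \<beta> H H' \<gamma>
  assume "\<alpha> \<in> cells ?K F F'" "\<beta> \<in> cells ?K G G'" "\<gamma> \<in> cells ?K H H'"
    and "Cod ?K F = Dom ?K G" "Cod ?K G = Dom ?K H"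
  then have a: "internal_nat E \<alpha>" "ndom \<alpha> = F" "ncod \<alpha> = F'"
    and b: "internal_nat E \<beta>" "ndom \<beta> = G" "ncod \<beta> = G'"
    and c: "internal_nat E \<gamma>" "ndom \<gamma> = H" "ncod \<gamma> = H'"
    and e: "fdom G = fcod F" "fdom H = fcod G" by (simp_all add: cells_Cat Cat_simps)
  note N = inatD[OF a refl refl] and N' = inatD[OF b e(1) refl] and N'' = inatD[OF c e(2) refl]
  note F = ifunD[OF N(1) refl refl] and F' = ifunD[OF N(2,3,4)]
    and G = ifunD[OF N'(1) e(1) refl] and G' = ifunD[OF N'(2,3,4)]
    and H = ifunD[OF N''(1) e(2) refl] and H' = ifunD[OF N''(2,3,4)]
  have m: "itgt (fcod G) \<cdot> farr G \<cdot> ncomp \<alpha> = isrc (fcod G) \<cdot> ncomp \<beta> \<cdot> fob F'"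
    using ifun_src[OF N'(1) e(1) refl N(5)] inat_src[OF b e(1) refl F'(3)] N by simp
  note h1 = Comp_hom[OF N(5) G(4)] and h2 = Comp_hom[OF F'(3) N'(5)]
  have "icomp E (fcod H) ((farr H \<cdot> farr G) \<cdot> ncomp \<alpha>)
      (icomp E (fcod H) (farr H \<cdot> ncomp \<beta>) (ncomp \<gamma> \<cdot> fob G') \<cdot> fob F')
    = icomp E (fcod H) (farr H \<cdot> farr G \<cdot> ncomp \<alpha>)
      (icomp E (fcod H) (farr H \<cdot> ncomp \<beta> \<cdot> fob F') (ncomp \<gamma> \<cdot> fob G' \<cdot> fob F'))"
  proof -
    have "itgt (fcod H) \<cdot> farr H \<cdot> ncomp \<beta> = isrc (fcod H) \<cdot> ncomp \<gamma> \<cdot> fob G'"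
      using ifun_src[OF N''(1) e(2) refl N'(5)] inat_src[OF c e(2) refl G'(3)] N' by simp
    from icomp_Comp[OF H(2) Comp_hom[OF N'(5) H(4)] Comp_hom[OF G'(3) N''(5)] this F'(3)]
    show ?thesis
      using Comp_assoc[OF N(5) G(4) H(4)] Comp_assoc[OF F'(3) N'(5) H(4)]
        Comp_assoc[OF F'(3) G'(3) N''(5)] by simp
  qed
  also have "\<dots> = icomp E (fcod H)
      (icomp E (fcod H) (farr H \<cdot> farr G \<cdot> ncomp \<alpha>) (farr H \<cdot> ncomp \<beta> \<cdot> fob F'))
      (ncomp \<gamma> \<cdot> fob G' \<cdot> fob F')"
    using Comp_hom[OF h1 H(4)] Comp_hom[OF h2 H(4)] inat_src[OF c e(2) refl Comp_hom[OF F'(3) G'(3)]]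
      ifun_src[OF N''(1) e(2) refl h1] ifun_src[OF N''(1) e(2) refl h2] m
      inat_src[OF b e(1) refl F'(3)]
    by (intro icomp_assoc[OF H(2), symmetric]) simp_all
  also have "icomp E (fcod H) (farr H \<cdot> farr G \<cdot> ncomp \<alpha>) (farr H \<cdot> ncomp \<beta> \<cdot> fob F')
      = farr H \<cdot> icomp E (fcod G) (farr G \<cdot> ncomp \<alpha>) (ncomp \<beta> \<cdot> fob F')"
    by (rule ifun_icomp[OF N''(1) e(2) refl h1 h2 m, symmetric])
  finally show "(\<gamma> \<star>\<^bsub>?K\<^esub> \<beta>) \<star>\<^bsub>?K\<^esub> \<alpha> = \<gamma> \<star>\<^bsub>?K\<^esub> (\<beta> \<star>\<^bsub>?K\<^esub> \<alpha>)"
    using a b c e Comp_assoc[OF F(3) G(3) H(3)] Comp_assoc[OF F(4) G(4) H(4)]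
      Comp_assoc[OF F'(3) G'(3) H'(3)] Comp_assoc[OF F'(4) G'(4) H'(4)]
    by (simp add: Cat_simps)
next
  let ?K = "Cat E"
  fix F A B G C assume "F \<in> hom ?K A B" "G \<in> hom ?K B C"
  then have F0: "internal_functor E F" "fdom F = A" "fcod F = B"
    and G0: "internal_functor E G" "fdom G = B" "fcod G = C" by (auto simp: hom_Cat)
  note F = ifunD[OF F0] and G = ifunD[OF G0]
  note B = icatD[OF F(2)] and C = icatD[OF G(2)]
  note h = Comp_hom[OF F(3) G(3)]
  have "farr G \<cdot> iunit B \<cdot> fob F = iunit C \<cdot> fob G \<cdot> fob F"
    using Comp_assoc[OF F(3) B(5) G(4)] G(7) Comp_assoc[OF F(3) G(3) C(5)] by simp
  moreover have "icomp E C (iunit C \<cdot> fob G \<cdot> fob F) (iunit C \<cdot> fob G \<cdot> fob F) = iunit C \<cdot> fob G \<cdot> fob F"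
    using Comp_hom[OF h C(5)] Comp_assoc[OF h C(5) C(3)] C(7) Ide_Comp[OF h]
    by (intro icomp_unit_left[OF G(2)]) simp_all
  ultimately show "CIde ?K G \<star>\<^bsub>?K\<^esub> CIde ?K F = CIde ?K (G \<cdot>\<^bsub>?K\<^esub> F)"
    using F0 G0 Comp_assoc[OF F(3) G(3) C(5)] by (simp add: Cat_simps)
next
  let ?K = "Cat E"
  fix F G \<alpha> H \<alpha>' P Q \<beta> R \<beta>'
  assume "\<alpha> \<in> cells ?K F G" "\<alpha>' \<in> cells ?K G H" "\<beta> \<in> cells ?K P Q" "\<beta>' \<in> cells ?K Q R"
    and "Cod ?K F = Dom ?K P"
  then have a: "internal_nat E \<alpha>" "ndom \<alpha> = F" "ncod \<alpha> = G"
    and a': "internal_nat E \<alpha>'" "ndom \<alpha>' = G" "ncod \<alpha>' = H"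
    and b: "internal_nat E \<beta>" "ndom \<beta> = P" "ncod \<beta> = Q"
    and b': "internal_nat E \<beta>'" "ndom \<beta>' = Q" "ncod \<beta>' = R"
    and e: "fdom P = fcod F" by (simp_all add: cells_Cat Cat_simps)
  define C where "C = fcod P"
  note Cs = C_def[symmetric]
  note N = inatD[OF a refl refl]
  note N2 = inatD[OF a' N(3,4)]
  note M = inatD[OF b e Cs]
  note M2 = inatD[OF b' M(3,4)]
  note F = ifunD[OF N(1) refl refl] and G = ifunD[OF N(2,3,4)] and H = ifunD[OF N2(2,3,4)]
    and P = ifunD[OF M(1) e Cs] and Q = ifunD[OF M(2,3,4)] and R = ifunD[OF M2(2,3,4)]
  note fP = ifun_src[OF M(1) e Cs] and fQ = ifun_src[OF M(2,3,4)]
  note nb = inat_src[OF b e Cs] and nb' = inat_src[OF b' M(3,4)]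
  let ?c = "icomp E C"
  let ?a1 = "farr P \<cdot> ncomp \<alpha>" let ?a2 = "farr P \<cdot> ncomp \<alpha>'"
  let ?b1 = "ncomp \<beta> \<cdot> fob H" let ?b2 = "ncomp \<beta>' \<cdot> fob H"
  let ?b0 = "ncomp \<beta> \<cdot> fob G" let ?a3 = "farr Q \<cdot> ncomp \<alpha>'"
  have hs: "?a1 \<in> hom E (iob (fdom F)) (iarr C)" "?a2 \<in> hom E (iob (fdom F)) (iarr C)"
    "?a3 \<in> hom E (iob (fdom F)) (iarr C)"
    using Comp_hom[OF N(5) P(4)] Comp_hom[OF N2(5) P(4)] Comp_hom[OF N2(5) Q(4)] by auto
  have st: "isrc C \<cdot> ?a1 = fob P \<cdot> fob F" "itgt C \<cdot> ?a1 = fob P \<cdot> fob G"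
    "isrc C \<cdot> ?a2 = fob P \<cdot> fob G" "itgt C \<cdot> ?a2 = fob P \<cdot> fob H"
    "isrc C \<cdot> ?a3 = fob Q \<cdot> fob G" "itgt C \<cdot> ?a3 = fob Q \<cdot> fob H"
    using fP[OF N(5)] fP[OF N2(5)] fQ[OF N2(5)] N N2 by simp_all
  have m: "itgt (fcod F) \<cdot> ncomp \<alpha> = isrc (fcod F) \<cdot> ncomp \<alpha>'" using N N2 by simp
  have m': "itgt C \<cdot> ncomp \<beta> = isrc C \<cdot> ncomp \<beta>'" using M M2 by simp
  have "?c (farr P \<cdot> icomp E (fcod F) (ncomp \<alpha>) (ncomp \<alpha>')) (?c (ncomp \<beta>) (ncomp \<beta>') \<cdot> fob H)
      = ?c (?c ?a1 ?a2) (?c ?b1 ?b2)"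
    using ifun_icomp[OF M(1) e Cs N(5) N2(5) m] icomp_Comp[OF P(2) M(5) M2(5) m' H(3)] by simp
  also have "\<dots> = ?c ?a1 (?c ?a2 (?c ?b1 ?b2))"
    using hs st nb[OF H(3)] nb'[OF H(3)]
      icomp_hom[OF P(2) nb(1)[OF H(3)] nb'(1)[OF H(3)]]
    by (intro icomp_assoc[OF P(2)]) simp_all
  also have "?c ?a2 (?c ?b1 ?b2) = ?c (?c ?a2 ?b1) ?b2"
    using hs st nb[OF H(3)] nb'[OF H(3)] by (intro icomp_assoc[OF P(2), symmetric]) simp_all
  also have "?c ?a2 ?b1 = ?c ?b0 ?a3"
    using HComp_arr[OF a'(1) b(1)] a' b N e Cs by simp
  also have "?c (?c ?b0 ?a3) ?b2 = ?c ?b0 (?c ?a3 ?b2)"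
    using hs st nb[OF G(3)] nb'[OF H(3)] by (intro icomp_assoc[OF P(2)]) simp_all
  also have "?c ?a1 \<dots> = ?c (?c ?a1 ?b0) (?c ?a3 ?b2)"
    using hs st nb[OF G(3)] nb'[OF H(3)] icomp_hom[OF P(2) hs(3) nb'(1)[OF H(3)]]
    by (intro icomp_assoc[OF P(2), symmetric]) simp_all
  finally show "(\<beta>' \<bullet>\<^bsub>?K\<^esub> \<beta>) \<star>\<^bsub>?K\<^esub> (\<alpha>' \<bullet>\<^bsub>?K\<^esub> \<alpha>) = (\<beta>' \<star>\<^bsub>?K\<^esub> \<alpha>') \<bullet>\<^bsub>?K\<^esub> (\<beta> \<star>\<^bsub>?K\<^esub> \<alpha>)"
    using a a' b b' e Cs M by (simp add: Cat_simps)
qed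

end

end

theory Submission
  imports Defs
begin

text \<open>A functor \<open>F : A \<rightarrow> B\<close> is fully faithful iff the arrows of \<open>A\<close> are those of \<open>B\<close> pulled back along
  its object part, so lifting a functor through \<open>F\<close> amounts to lifting its object part. Hence \<open>F\<close> has
  a section iff its object part has one, and any functor with epic object part is acute, because full
  monomorphisms are monic on objects. Conversely the object part of an acute functor is epic: the
  functor factors through the full subcategory on the image of its object part. Finally, every
  epimorphism \<open>e : X \<rightarrow> Y\<close> is the object part of a fully faithful functor, from its kernel pair to the
  discrete category on \<open>Y\<close>.\<close>

section \<open>Full faithfulness on generalised elements; discrete internal categories\<close>

text \<open>Unfolds the statement that \<open>iarr (fdom F)\<close> is the limit of
  \<open>fob F\<close>, \<open>isrc\<close>, \<open>itgt\<close> and \<open>fob F\<close>: an arrow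
  upstairs is an arrow downstairs with chosen lifts of both ends. Quantifying over generalised
  elements avoids choosing a product of the object of objects with itself.\<close>

definition internally_ff :: "('o, 'a, 'm) cat_scheme \<Rightarrow> ('o, 'a) ifun \<Rightarrow> bool" where
  "internally_ff E F \<longleftrightarrow> internal_functor E F \<and>
    (\<forall>Z. \<forall>x \<in> hom E Z (iob (fdom F)). \<forall>y \<in> hom E Z (iob (fdom F)). \<forall>b \<in> hom E Z (iarr (fcod F)).
      isrc (fcod F) \<cdot>\<^bsub>E\<^esub> b = fob F \<cdot>\<^bsub>E\<^esub> x \<longrightarrow> itgt (fcod F) \<cdot>\<^bsub>E\<^esub> b = fob F \<cdot>\<^bsub>E\<^esub> y \<longrightarrow>
      (\<exists>!a. a \<in> hom E Z (iarr (fdom F)) \<and> isrc (fdom F) \<cdot>\<^bsub>E\<^esub> a = x \<and> itgt (fdom F) \<cdot>\<^bsub>E\<^esub> a = y \<and>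
        farr F \<cdot>\<^bsub>E\<^esub> a = b))"

text \<open>Composable arrows coincide here, so either pullback projection could serve as the
  composition.\<close>

definition discrete_icat :: "('o, 'a, 'm) cat_scheme \<Rightarrow> 'o \<Rightarrow> ('o, 'a) icat" where
  "discrete_icat E X = \<lparr>iob = X, iarr = X, isrc = Ide E X, itgt = Ide E X, iunit = Ide E X,
    imul = pb1 E (Ide E X) (Ide E X)\<rparr>"

text \<open>A generalised object \<open>x\<close> of \<open>A\<close> seen as a functor;
  preservation of units forces this arrow part.\<close>

definition discrete_ifun :: "('o, 'a, 'm) cat_scheme \<Rightarrow> 'o \<Rightarrow> ('o, 'a) icat \<Rightarrow> 'a \<Rightarrow> ('o, 'a) ifun" where
  "discrete_ifun E X A x = \<lparr>fdom = discrete_icat E X, fcod = A, fob = x, farr = iunit A \<cdot>\<^bsub>E\<^esub> x\<rparr>"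

section \<open>Epimorphisms, sections and orthogonality in general categories and
  2-categories\<close>

lemma (in category) epic_Comp:
  assumes "epic E e" "epic E m" "Cod E e = Dom E m"
  shows "epic E (m \<cdot> e)"
  unfolding epic_def
proof (intro conjI allI ballI impI)
  have e: "e \<in> hom E (Dom E e) (Dom E m)" and m: "m \<in> hom E (Dom E m) (Cod E m)"
    using assms by (auto simp: epic_def hom_def)
  note me = Comp_hom[OF e m]
  then show "m \<cdot> e \<in> Ar E" by (simp add: hom_def)
  have c: "Cod E (m \<cdot> e) = Cod E m" using me by (simp add: hom_def)
  fix B g h
  assume "g \<in> hom E (Cod E (m \<cdot> e)) B" "h \<in> hom E (Cod E (m \<cdot> e)) B"
    and eq: "g \<cdot> m \<cdot> e = h \<cdot> m \<cdot> e"
  then have g: "g \<in> hom E (Cod E m) B" and h: "h \<in> hom E (Cod E m) B" using c by auto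
  have "(g \<cdot> m) \<cdot> e = (h \<cdot> m) \<cdot> e"
    using eq Comp_assoc[OF e m g] Comp_assoc[OF e m h] by simp
  then have "g \<cdot> m = h \<cdot> m"
    using assms(1,3) Comp_hom[OF m g] Comp_hom[OF m h] unfolding epic_def by metis
  then show "g = h" using assms(2) g h unfolding epic_def by blast
qed

lemma (in category) has_section_epic:
  assumes "m \<in> Ar E" "has_section E m"
  shows "epic E m"
  unfolding epic_def
proof (intro conjI allI ballI impI)
  obtain s where s: "s \<in> hom E (Cod E m) (Dom E m)" "m \<cdot> s = Ide E (Cod E m)"
    using assms(2) unfolding has_section_def by blast
  have m: "m \<in> hom E (Dom E m) (Cod E m)" using assms(1) by (simp add: hom_def)
  fix B g h
  assume g: "g \<in> hom E (Cod E m) B" and h: "h \<in> hom E (Cod E m) B" and eq: "g \<cdot> m = h \<cdot> m"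
  show "g = h"
    using Comp_assoc[OF s(1) m g] Comp_assoc[OF s(1) m h] eq s(2) Comp_Ide[OF g] Comp_Ide[OF h]
    by metis
qed (rule assms(1))

text \<open>For a fully faithful \<open>f\<close> the two-dimensional part of orthogonality is automatic.\<close>

lemma (in two_category) orthogonal2I:
  assumes s: "s \<in> Ar K" and f: "fully_faithful K f" and o: "orthogonal K s f"
  shows "orthogonal2 K s f"
  unfolding orthogonal2_def
proof (intro conjI o ballI impI, elim conjE)
  fix p p' q q' u u' \<alpha> \<beta>
  assume p: "p \<in> hom K (Dom K s) (Dom K f)" "p' \<in> hom K (Dom K s) (Dom K f)"
    and u: "u \<in> hom K (Cod K s) (Dom K f)" "u' \<in> hom K (Cod K s) (Dom K f)"
    and \<alpha>: "\<alpha> \<in> cells K p p'" and \<beta>: "\<beta> \<in> cells K q q'"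
    and e: "lwhisker K f \<alpha> = rwhisker K \<beta> s" "f \<cdot> u = q" "u \<cdot> s = p" "f \<cdot> u' = q'" "u' \<cdot> s = p'"
  have fA: "f \<in> Ar K" using f by (simp add: fully_faithful_def)
  have ob: "Dom K s \<in> Ob K" "Cod K s \<in> Ob K" using s Dom_Ob Cod_Ob by auto
  have bij: "bij_betw (lwhisker K f) (cells K g h) (cells K (f \<cdot> g) (f \<cdot> h))"
    if "Z \<in> Ob K" "g \<in> hom K Z (Dom K f)" "h \<in> hom K Z (Dom K f)" for Z g h
    using f that unfolding fully_faithful_def by blast
  note b1 = bij[OF ob(2) u] and b2 = bij[OF ob(1) p]
  have ex: "\<exists>!\<gamma>. \<gamma> \<in> cells K u u' \<and> lwhisker K f \<gamma> = \<beta>"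
  proof (rule ex_ex1I)
    show "\<exists>\<gamma>. \<gamma> \<in> cells K u u' \<and> lwhisker K f \<gamma> = \<beta>"
      using bij_betw_imp_surj_on[OF b1, symmetric] \<beta> e(2,4) by auto
  qed (use bij_betw_imp_inj_on[OF b1] in \<open>auto dest: inj_onD\<close>)
  have "rwhisker K \<gamma> s = \<alpha>" if \<gamma>: "\<gamma> \<in> cells K u u'" "lwhisker K f \<gamma> = \<beta>" for \<gamma>
  proof -
    have d: "Cod K s = Dom K u" "Cod K u = Dom K f" using u by (auto simp: hom_def)
    have r: "rwhisker K \<gamma> s \<in> cells K p p'"
      unfolding rwhisker_def using HComp_cells[OF CIde_cells[OF s] \<gamma>(1) d(1)] e(3,5) by simp
    \<comment> \<open>Whiskering by \<open>f\<close> on the left and by \<open>s\<close> on the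
      right commute, so \<open>rwhisker K \<gamma> s\<close> and \<alpha> have the same image under
      \<open>f\<close>; faithfulness on cells out of \<open>Dom K s\<close> then identifies
      them.\<close>
    have "lwhisker K f (rwhisker K \<gamma> s) = rwhisker K (lwhisker K f \<gamma>) s"
      unfolding rwhisker_def lwhisker_def
      using HComp_assoc[OF CIde_cells[OF s] \<gamma>(1) CIde_cells[OF fA] d] by simp
    then have "lwhisker K f (rwhisker K \<gamma> s) = lwhisker K f \<alpha>" using \<gamma>(2) e(1) by simp
    from inj_onD[OF bij_betw_imp_inj_on[OF b2] this r \<alpha>] show ?thesis .
  qed
  with ex show "\<exists>!\<gamma>. \<gamma> \<in> cells K u u' \<and> lwhisker K f \<gamma> = \<beta> \<and> rwhisker K \<gamma> s = \<alpha>" by blast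
qed

section \<open>Constructing internal categories; functors and transformations out of discrete
  ones\<close>

context pullback_category
begin

text \<open>A Yoneda argument: the axioms speak of the universal composable pair and triple, which
  are particular generalised arrows, so laws for all generalised arrows suffice.\<close>

lemma icatI:
  assumes C: "iob C \<in> Ob E" "iarr C \<in> Ob E"
    "isrc C \<in> hom E (iarr C) (iob C)" "itgt C \<in> hom E (iarr C) (iob C)"
    "iunit C \<in> hom E (iob C) (iarr C)"
    "imul C \<in> hom E (pbo E (itgt C) (isrc C)) (iarr C)"
    "isrc C \<cdot> iunit C = Ide E (iob C)" "itgt C \<cdot> iunit C = Ide E (iob C)"
    and st: "\<And>Z a b. a \<in> hom E Z (iarr C) \<Longrightarrow> b \<in> hom E Z (iarr C) \<Longrightarrow> itgt C \<cdot> a = isrc C \<cdot> b \<Longrightarrow>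
      isrc C \<cdot> icomp E C a b = isrc C \<cdot> a \<and> itgt C \<cdot> icomp E C a b = itgt C \<cdot> b"
    and unit: "\<And>Z a. a \<in> hom E Z (iarr C) \<Longrightarrow>
      icomp E C (iunit C \<cdot> isrc C \<cdot> a) a = a \<and> icomp E C a (iunit C \<cdot> itgt C \<cdot> a) = a"
    and assoc: "\<And>Z a b c. a \<in> hom E Z (iarr C) \<Longrightarrow> b \<in> hom E Z (iarr C) \<Longrightarrow> c \<in> hom E Z (iarr C) \<Longrightarrow>
      itgt C \<cdot> a = isrc C \<cdot> b \<Longrightarrow> itgt C \<cdot> b = isrc C \<cdot> c \<Longrightarrow>
      icomp E C (icomp E C a b) c = icomp E C a (icomp E C b c)"
  shows "internal_category E C"
proof -
  define p where "p = pb1 E (itgt C) (isrc C)"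
  define q where "q = pb2 E (itgt C) (isrc C)"
  define r1 where "r1 = pb1 E q p"
  define r2 where "r2 = pb2 E q p"
  note P = pb_hom[OF C(4,3), folded p_def q_def]
  note R = pb_hom[OF P(2,1), folded r1_def r2_def]
  \<comment> \<open>Every \<open>u\<close> into the object of composable pairs is the tuple of its
    own components. The identity, taken as \<open>u\<close>, yields the universal pair.\<close>
  have mul: "icomp E C (p \<cdot> u) (q \<cdot> u) = imul C \<cdot> u" if u: "u \<in> hom E Z (pbo E (itgt C) (isrc C))" for Z u
  proof -
    have "tup E (itgt C) (isrc C) (p \<cdot> u) (q \<cdot> u) = u"
      using Comp_assoc[OF u P(1) C(4)] Comp_assoc[OF u P(2) C(3)] P(3)
      by (intro tup_unique[OF C(4,3) Comp_hom[OF u P(1)] Comp_hom[OF u P(2)] _ u])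
        (simp_all add: p_def q_def)
    then show ?thesis by (simp add: icomp_def)
  qed
  have "Ide E (pbo E (itgt C) (isrc C)) \<in> hom E (pbo E (itgt C) (isrc C)) (pbo E (itgt C) (isrc C))"
    using Ide_hom hom_Ob P(1) by blast
  from mul[OF this] have m: "icomp E C p q = imul C" using Comp_Ide P C(6) by simp
  have mc: "isrc C \<cdot> imul C = isrc C \<cdot> p" "itgt C \<cdot> imul C = itgt C \<cdot> q"
    using st[OF P] m by simp_all
  have I: "Ide E (iarr C) \<in> hom E (iarr C) (iarr C)" using Ide_hom C(2) .
  have u: "icomp E C (iunit C \<cdot> isrc C) (Ide E (iarr C)) = Ide E (iarr C)"
    "icomp E C (Ide E (iarr C)) (iunit C \<cdot> itgt C) = Ide E (iarr C)"
    using unit[OF I] Comp_Ide[OF C(3)] Comp_Ide[OF C(4)] by simp_all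
  \<comment> \<open>The universal composable triple is \<open>p \<cdot> r1\<close>, then
    \<open>q \<cdot> r1\<close>, which equals \<open>p \<cdot> r2\<close>, then
    \<open>q \<cdot> r2\<close>; \<open>assoc\<close> at this triple is the required axiom.\<close>
  have pr: "q \<cdot> r1 = p \<cdot> r2" using R(3) .
  have "itgt C \<cdot> p \<cdot> r1 = isrc C \<cdot> q \<cdot> r1" "itgt C \<cdot> p \<cdot> r2 = isrc C \<cdot> q \<cdot> r2"
    using Comp_assoc[OF R(1) P(1) C(4)] Comp_assoc[OF R(1) P(2) C(3)]
      Comp_assoc[OF R(2) P(1) C(4)] Comp_assoc[OF R(2) P(2) C(3)] P(3) by simp_all
  with assoc[OF Comp_hom[OF R(1) P(1)] Comp_hom[OF R(1) P(2)] Comp_hom[OF R(2) P(2)]]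
  have "icomp E C (imul C \<cdot> r1) (q \<cdot> r2) = icomp E C (p \<cdot> r1) (imul C \<cdot> r2)"
    using mul[OF R(1)] mul[OF R(2)] pr by simp
  then show ?thesis
    unfolding internal_category_def Let_def p_def[symmetric] q_def[symmetric]
      r1_def[symmetric] r2_def[symmetric]
    using C mc u by simp
qed

lemma icomp_discrete:
  assumes "X \<in> Ob E" "a \<in> hom E Z X"
  shows "icomp E (discrete_icat E X) a a = a"
  using tup[OF Ide_hom[OF assms(1)] Ide_hom[OF assms(1)] assms(2,2) refl]
  by (simp add: icomp_def discrete_icat_def)

lemma internal_category_discrete:
  assumes X: "X \<in> Ob E"
  shows "internal_category E (discrete_icat E X)"
proof -
  note I = Ide_hom[OF X]
  \<comment> \<open>Source and target are both the identity, so composability means equality and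
    \<open>icomp_discrete\<close> computes every composite.\<close>
  have ab: "a = b" if "a \<in> hom E Z X" "b \<in> hom E Z X" "Ide E X \<cdot> a = Ide E X \<cdot> b" for Z a b
    using that Ide_Comp by metis
  show ?thesis
  proof (rule icatI, goal_cases)
    case (9 Z a b)
    then show ?case using ab[of a Z b] icomp_discrete[OF X, of a Z] by (simp add: discrete_icat_def)
  next
    case (10 Z a)
    then show ?case using icomp_discrete[OF X, of a Z] Ide_Comp by (simp add: discrete_icat_def)
  next
    case (11 Z a b c)
    then have "a = b" "b = c" using ab by (simp_all add: discrete_icat_def)
    then show ?case by (simp add: discrete_icat_def) (use 11 icomp_discrete[OF X, of a Z] in \<open>simp add: discrete_icat_def\<close>)
  qed (use X I pb_hom[OF I I] Comp_Ide[OF I] in \<open>simp_all add: discrete_icat_def\<close>)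
qed

lemma internal_functor_discrete:
  assumes A: "internal_category E A" and x: "x \<in> hom E X (iob A)"
  shows "internal_functor E (discrete_ifun E X A x)"
proof -
  have X: "X \<in> Ob E" using hom_Ob[OF x] by simp
  note D = icatD[OF A]
  have h: "iunit A \<cdot> x \<in> hom E X (iarr A)" using Comp_hom[OF x D(5)] .
  have st: "isrc A \<cdot> iunit A \<cdot> x = x" "itgt A \<cdot> iunit A \<cdot> x = x"
    using Comp_assoc[OF x D(5,3)] Comp_assoc[OF x D(5,4)] D(7,8) Ide_Comp[OF x] by simp_all
  show ?thesis
  proof (rule ifunI[OF internal_category_discrete[OF X] A])
    fix Z a b
    assume "a \<in> hom E Z (iarr (discrete_icat E X))" "b \<in> hom E Z (iarr (discrete_icat E X))"
      "itgt (discrete_icat E X) \<cdot> a = isrc (discrete_icat E X) \<cdot> b"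
    then have a: "a \<in> hom E Z X" and b: "b = a" using Ide_Comp by (simp_all add: discrete_icat_def)
    \<comment> \<open>Preservation of composition amounts to a unit arrow composed with itself being
      itself, an instance of the left unit law.\<close>
    have "isrc A \<cdot> iunit A \<cdot> x \<cdot> a = x \<cdot> a"
      using Comp_assoc[OF a h D(3)] Comp_assoc[OF a x D(5)] st by simp
    from icomp_unit_left[OF A Comp_hom[OF Comp_hom[OF a x] D(5)] this]
    show "farr (discrete_ifun E X A x) \<cdot> icomp E (discrete_icat E X) a b =
      icomp E A (farr (discrete_ifun E X A x) \<cdot> a) (farr (discrete_ifun E X A x) \<cdot> b)"
      using b icomp_discrete[OF X a] Comp_assoc[OF a x D(5)] by (simp add: discrete_ifun_def)
  qed (use x h st Comp_Ide[OF x] Comp_Ide[OF h] in \<open>simp_all add: discrete_icat_def discrete_ifun_def\<close>)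
qed

text \<open>On a discrete domain naturality reduces to the two unit laws, so generalised arrows of
  \<open>A\<close> can serve as 2-cells when \<open>Cat E\<close> is tested for full
  faithfulness.\<close>

lemma internal_nat_discrete:
  assumes A: "internal_category E A" and a: "a \<in> hom E X (iarr A)"
  shows "internal_nat E \<lparr>ndom = discrete_ifun E X A (isrc A \<cdot> a),
    ncod = discrete_ifun E X A (itgt A \<cdot> a), ncomp = a\<rparr>"
proof -
  note D = icatD[OF A]
  note f = internal_functor_discrete[OF A Comp_hom[OF a D(3)]]
    internal_functor_discrete[OF A Comp_hom[OF a D(4)]]
  show ?thesis
    by (rule inatI[OF f, where A = "discrete_icat E X" and B = A])
      (use a Comp_Ide[OF a] icomp_unit_left[OF A a refl] icomp_unit_right[OF A a refl]
        in \<open>simp_all add: discrete_ifun_def discrete_icat_def\<close>)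
qed

section \<open>Lifting through fully faithful functors; the internal and the 2-categorical notion
  agree\<close>

lemma internally_ffD:
  assumes "internally_ff E F" "fdom F = A" "fcod F = B"
  shows "internal_functor E F"
    and "\<And>Z x y b. x \<in> hom E Z (iob A) \<Longrightarrow> y \<in> hom E Z (iob A) \<Longrightarrow> b \<in> hom E Z (iarr B) \<Longrightarrow>
      isrc B \<cdot> b = fob F \<cdot> x \<Longrightarrow> itgt B \<cdot> b = fob F \<cdot> y \<Longrightarrow>
      \<exists>!a. a \<in> hom E Z (iarr A) \<and> isrc A \<cdot> a = x \<and> itgt A \<cdot> a = y \<and> farr F \<cdot> a = b"
  using assms unfolding internally_ff_def by blast+

text \<open>Both arrows solve the lifting problem posed by the source, target and image of
  \<open>a\<close>. This is how equations in the domain of \<open>F\<close> are reduced to equations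
  in its codomain below.\<close>

lemma internally_ff_cancel:
  assumes "internally_ff E F" "fdom F = A" "fcod F = B"
    and a: "a \<in> hom E Z (iarr A)" "b \<in> hom E Z (iarr A)"
    and eq: "isrc A \<cdot> a = isrc A \<cdot> b" "itgt A \<cdot> a = itgt A \<cdot> b" "farr F \<cdot> a = farr F \<cdot> b"
  shows "a = b"
proof -
  note f = internally_ffD[OF assms(1-3)]
  note F = ifunD[OF f(1) assms(2,3)]
  note A = icatD[OF F(1)]
  note S = ifun_src[OF f(1) assms(2,3) a(1)]
  from f(2)[OF Comp_hom[OF a(1) A(3)] Comp_hom[OF a(1) A(4)] Comp_hom[OF a(1) F(4)] S]
  show ?thesis using a eq by metis
qed

text \<open>The arrow part is the unique arrow with ends prescribed by \<open>h\<close> and image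
  prescribed by \<open>G\<close>. The functor laws hold because the two sides of each have equal
  source, target and image under \<open>F\<close>.\<close>

lemma internally_ff_lift:
  assumes F: "internally_ff E F" "fdom F = A" "fcod F = B"
    and G: "internal_functor E G" "fdom G = C" "fcod G = B"
    and h: "h \<in> hom E (iob C) (iob A)" "fob F \<cdot> h = fob G"
  shows "\<exists>!H. H \<in> hom (Cat E) C A \<and> fob H = h \<and> F \<cdot>\<^bsub>Cat E\<^esub> H = G"
proof -
  note f = internally_ffD[OF F]
  note F' = ifunD[OF f(1) F(2,3)] and G' = ifunD[OF G]
  note A = icatD[OF F'(1)] and B = icatD[OF F'(2)] and C = icatD[OF G'(1)]
  note fS = ifun_src[OF f(1) F(2,3)] and gS = ifun_src[OF G]
  \<comment> \<open>Full faithfulness is applied with \<open>Z\<close> the object of arrows of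
    \<open>C\<close>, that is, to the universal arrow of \<open>C\<close>.\<close>
  have "isrc B \<cdot> farr G = fob F \<cdot> h \<cdot> isrc C" "itgt B \<cdot> farr G = fob F \<cdot> h \<cdot> itgt C"
    using G'(5,6) h(2) Comp_assoc[OF C(3) h(1) F'(3)] Comp_assoc[OF C(4) h(1) F'(3)] by simp_all
  from f(2)[OF Comp_hom[OF C(3) h(1)] Comp_hom[OF C(4) h(1)] G'(4) this]
  obtain k where k: "k \<in> hom E (iarr C) (iarr A)" "isrc A \<cdot> k = h \<cdot> isrc C" "itgt A \<cdot> k = h \<cdot> itgt C"
    "farr F \<cdot> k = farr G" by blast
  define H where "H = \<lparr>fdom = C, fcod = A, fob = h, farr = k\<rparr>"
  have ks: "k \<cdot> x \<in> hom E Z (iarr A)" "isrc A \<cdot> k \<cdot> x = h \<cdot> isrc C \<cdot> x" "itgt A \<cdot> k \<cdot> x = h \<cdot> itgt C \<cdot> x"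
    "farr F \<cdot> k \<cdot> x = farr G \<cdot> x" if x: "x \<in> hom E Z (iarr C)" for x Z
    using Comp_hom[OF x k(1)] Comp_assoc[OF x k(1) A(3)] Comp_assoc[OF x k(1) A(4)]
      Comp_assoc[OF x k(1) F'(4)] Comp_assoc[OF x C(3) h(1)] Comp_assoc[OF x C(4) h(1)] k by simp_all
  have "internal_functor E H"
  proof (rule ifunI[OF G'(1) F'(1)])
    have "k \<cdot> iunit C = iunit A \<cdot> h"
      by (rule internally_ff_cancel[OF F])
        (use ks[OF C(5)] Comp_hom[OF h(1) A(5)] C(7,8) Comp_Ide[OF h(1)] Ide_Comp[OF h(1)]
        Comp_assoc[OF h(1) A(5,3)] Comp_assoc[OF h(1) A(5,4)] A(7,8) G'(7) h(2)
        Comp_assoc[OF h(1) A(5) F'(4)] Comp_assoc[OF h(1) F'(3) B(5)] F'(7) in simp_all)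
    then show "farr H \<cdot> iunit C = iunit A \<cdot> fob H" by (simp add: H_def)
    fix Z a b
    assume ab: "a \<in> hom E Z (iarr C)" "b \<in> hom E Z (iarr C)" "itgt C \<cdot> a = isrc C \<cdot> b"
    have eq: "itgt A \<cdot> k \<cdot> a = isrc A \<cdot> k \<cdot> b" using ks[OF ab(1)] ks[OF ab(2)] ab(3) by simp
    note c = icomp_hom[OF G'(1) ab] and c' = icomp_hom[OF F'(1) ks(1)[OF ab(1)] ks(1)[OF ab(2)] eq]
    have "k \<cdot> icomp E C a b = icomp E A (k \<cdot> a) (k \<cdot> b)"
      by (rule internally_ff_cancel[OF F])
        (use ks[OF c(1)] c c' ks[OF ab(1)] ks[OF ab(2)] ifun_icomp[OF G ab]
        ifun_icomp[OF f(1) F(2,3) ks(1)[OF ab(1)] ks(1)[OF ab(2)] eq] in simp_all)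
    then show "farr H \<cdot> icomp E C a b = icomp E A (farr H \<cdot> a) (farr H \<cdot> b)" by (simp add: H_def)
  qed (use h k in \<open>simp_all add: H_def\<close>)
  moreover have "F \<cdot>\<^bsub>Cat E\<^esub> H = G" using F G h k by (simp add: Cat_simps H_def)
  moreover have "H' = H" if H': "H' \<in> hom (Cat E) C A" "fob H' = h" "F \<cdot>\<^bsub>Cat E\<^esub> H' = G" for H'
  proof -
    have i: "internal_functor E H'" "fdom H' = C" "fcod H' = A" using H'(1) by (simp_all add: hom_Cat)
    note i' = ifunD[OF i]
    have e0: "farr F \<cdot> farr H' = farr G" using H'(3) by (auto simp: Cat_simps)
    have "farr H' = k"
      by (rule internally_ff_cancel[OF F])
        (use e0 i' k H'(2) in simp_all)
    then show ?thesis using i H'(2) by (simp add: H_def)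
  qed
  ultimately show ?thesis
    by (intro ex1I[of _ H]) (simp_all add: hom_Cat, simp_all add: H_def)
qed

text \<open>Horizontal composition with the identity cell of \<open>F\<close> only adds a unit on
  the right, which the unit law removes.\<close>

lemma lwhisker_Cat:
  assumes F: "internal_functor E F" and \<alpha>: "\<alpha> \<in> cells (Cat E) G H" and c: "fcod G = fdom F"
  shows "lwhisker (Cat E) F \<alpha> =
    \<lparr>ndom = F \<cdot>\<^bsub>Cat E\<^esub> G, ncod = F \<cdot>\<^bsub>Cat E\<^esub> H, ncomp = farr F \<cdot> ncomp \<alpha>\<rparr>"
proof -
  have a: "internal_nat E \<alpha>" "ndom \<alpha> = G" "ncod \<alpha> = H" using \<alpha> by (simp_all add: cells_Cat)
  note N = inatD[OF a refl c]
  note F' = ifunD[OF F refl refl] and H = ifunD[OF N(2,3,4)]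
  note B = icatD[OF F'(2)]
  have "icomp E (fcod F) (farr F \<cdot> ncomp \<alpha>) (iunit (fcod F) \<cdot> fob F \<cdot> fob H) = farr F \<cdot> ncomp \<alpha>"
    using ifun_src(2)[OF F refl refl N(5)] N(7)
    by (intro icomp_unit_right[OF F'(2) Comp_hom[OF N(5) F'(4)]]) simp
  then show ?thesis
    using a Comp_assoc[OF H(3) F'(3) B(5)] by (simp add: lwhisker_def Cat_simps)
qed

text \<open>Whiskering with \<open>F\<close> acts on components by composition with
  \<open>farr F\<close>, and a component is a generalised arrow with prescribed ends, so cells lift
  uniquely because arrows do.\<close>

lemma internally_ff_imp_fully_faithful:
  assumes F: "internally_ff E F"
  shows "fully_faithful (Cat E) F"
  unfolding fully_faithful_def
proof (intro conjI ballI)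
  note f = internally_ffD[OF F refl refl]
  note F' = ifunD[OF f(1) refl refl]
  note A = icatD[OF F'(1)] and B = icatD[OF F'(2)]
  note fS = ifun_src[OF f(1) refl refl]
  show "F \<in> Ar (Cat E)" using f(1) by (simp add: Cat_simps)
  fix Z G H
  assume "G \<in> hom (Cat E) Z (Dom (Cat E) F)" "H \<in> hom (Cat E) Z (Dom (Cat E) F)"
  then have G: "internal_functor E G" "fdom G = Z" "fcod G = fdom F"
    and H: "internal_functor E H" "fdom H = Z" "fcod H = fdom F"
    by (simp_all add: hom_Cat) (simp_all add: Cat_simps)
  note G' = ifunD[OF G] and H' = ifunD[OF H]
  note Z = icatD[OF G'(1)]
  have FG: "fdom (F \<cdot>\<^bsub>Cat E\<^esub> G) = Z" "fcod (F \<cdot>\<^bsub>Cat E\<^esub> G) = fcod F" using G by (simp_all add: Cat_simps)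
  show "bij_betw (lwhisker (Cat E) F) (cells (Cat E) G H)
    (cells (Cat E) (F \<cdot>\<^bsub>Cat E\<^esub> G) (F \<cdot>\<^bsub>Cat E\<^esub> H))"
    unfolding bij_betw_def
  proof (intro conjI subset_antisym image_subsetI subsetI inj_onI)
    fix \<alpha> \<beta>
    assume \<alpha>: "\<alpha> \<in> cells (Cat E) G H" and \<beta>: "\<beta> \<in> cells (Cat E) G H"
      and eq: "lwhisker (Cat E) F \<alpha> = lwhisker (Cat E) F \<beta>"
    have a: "internal_nat E \<alpha>" "ndom \<alpha> = G" "ncod \<alpha> = H" and b: "internal_nat E \<beta>" "ndom \<beta> = G" "ncod \<beta> = H"
      using \<alpha> \<beta> by (simp_all add: cells_Cat)
    note N = inatD[OF a G(2,3)] and M = inatD[OF b G(2,3)]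
    have e0: "farr F \<cdot> ncomp \<alpha> = farr F \<cdot> ncomp \<beta>"
      using eq lwhisker_Cat[OF f(1) \<alpha> G(3)] lwhisker_Cat[OF f(1) \<beta> G(3)] by simp
    have "ncomp \<alpha> = ncomp \<beta>"
      by (rule internally_ff_cancel[OF F refl refl])
        (use e0 N M in simp_all)
    then show "\<alpha> = \<beta>" using a b by simp
  next
    fix \<alpha> assume \<alpha>: "\<alpha> \<in> cells (Cat E) G H"
    show "lwhisker (Cat E) F \<alpha> \<in> cells (Cat E) (F \<cdot>\<^bsub>Cat E\<^esub> G) (F \<cdot>\<^bsub>Cat E\<^esub> H)"
      unfolding lwhisker_def using two_category.HComp_cells[OF two_category_Cat \<alpha>
        two_category.CIde_cells[OF two_category_Cat, of F]] f(1) G(3)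
      by (simp add: Cat_simps(2-4))
  next
    fix \<beta> assume \<beta>: "\<beta> \<in> cells (Cat E) (F \<cdot>\<^bsub>Cat E\<^esub> G) (F \<cdot>\<^bsub>Cat E\<^esub> H)"
    then have b: "internal_nat E \<beta>" "ndom \<beta> = F \<cdot>\<^bsub>Cat E\<^esub> G" "ncod \<beta> = F \<cdot>\<^bsub>Cat E\<^esub> H"
      by (simp_all add: cells_Cat)
    note N = inatD[OF b FG]
    have s: "isrc (fcod F) \<cdot> ncomp \<beta> = fob F \<cdot> fob G" "itgt (fcod F) \<cdot> ncomp \<beta> = fob F \<cdot> fob H"
      using N by (simp_all add: Cat_simps)
    from f(2)[OF G'(3) H'(3) N(5) s]
    obtain a where a: "a \<in> hom E (iob Z) (iarr (fdom F))" "isrc (fdom F) \<cdot> a = fob G"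
      "itgt (fdom F) \<cdot> a = fob H" "farr F \<cdot> a = ncomp \<beta>" by blast
    have as: "a \<cdot> x \<in> hom E W (iarr (fdom F))" "isrc (fdom F) \<cdot> a \<cdot> x = fob G \<cdot> x"
      "itgt (fdom F) \<cdot> a \<cdot> x = fob H \<cdot> x" "farr F \<cdot> a \<cdot> x = ncomp \<beta> \<cdot> x" if x: "x \<in> hom E W (iob Z)" for W x
      using Comp_hom[OF x a(1)] Comp_assoc[OF x a(1) A(3)] Comp_assoc[OF x a(1) A(4)]
        Comp_assoc[OF x a(1) F'(4)] a by simp_all
    note a1 = as[OF Z(3)] and a2 = as[OF Z(4)]
    have t1: "itgt (fdom F) \<cdot> a \<cdot> isrc Z = isrc (fdom F) \<cdot> farr H" using a1 H' by simp
    have t2: "itgt (fdom F) \<cdot> farr G = isrc (fdom F) \<cdot> a \<cdot> itgt Z" using a2 G' by simp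
    note c1 = icomp_hom[OF F'(1) a1(1) H'(4) t1] and c2 = icomp_hom[OF F'(1) G'(4) a2(1) t2]
    have nat: "icomp E (fcod F) (ncomp \<beta> \<cdot> isrc Z) (farr F \<cdot> farr H) =
        icomp E (fcod F) (farr F \<cdot> farr G) (ncomp \<beta> \<cdot> itgt Z)"
      using N(8) by (simp add: Cat_simps)
    \<comment> \<open>Naturality of the lifted component: the two sides have the same ends, and
      their images under \<open>F\<close> agree by naturality of \<beta>.\<close>
    have "icomp E (fdom F) (a \<cdot> isrc Z) (farr H) = icomp E (fdom F) (farr G) (a \<cdot> itgt Z)"
      by (rule internally_ff_cancel[OF F refl refl])
        (use c1 c2 a1 a2 G' H' nat ifun_icomp[OF f(1) refl refl a1(1) H'(4) t1]
        ifun_icomp[OF f(1) refl refl G'(4) a2(1) t2] in simp_all)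
    then have "\<lparr>ndom = G, ncod = H, ncomp = a\<rparr> \<in> cells (Cat E) G H"
      unfolding cells_Cat using a by (intro conjI inatI[OF G(1) H(1) G(2,3) H(2,3)]) simp_all
    moreover from lwhisker_Cat[OF f(1) this G(3)]
    have "lwhisker (Cat E) F \<lparr>ndom = G, ncod = H, ncomp = a\<rparr> = \<beta>" using a b by simp
    ultimately show "\<beta> \<in> lwhisker (Cat E) F ` cells (Cat E) G H" by blast
  qed
qed

text \<open>Tested on the discrete category on \<open>Z\<close>: there \<open>x\<close> and
  \<open>y\<close> become functors and generalised arrows between them become cells, so the
  bijection on cells is the required unique lifting.\<close>

lemma fully_faithful_imp_internally_ff:
  assumes "fully_faithful (Cat E) F"
  shows "internally_ff E F"
  unfolding internally_ff_def
proof (intro conjI allI ballI impI)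
  show F: "internal_functor E F" using assms by (simp add: fully_faithful_def Cat_simps)
  note F' = ifunD[OF F refl refl]
  note A = icatD[OF F'(1)] and B = icatD[OF F'(2)]
  fix Z x y b
  assume x: "x \<in> hom E Z (iob (fdom F))" and y: "y \<in> hom E Z (iob (fdom F))"
    and b: "b \<in> hom E Z (iarr (fcod F))"
    and s: "isrc (fcod F) \<cdot> b = fob F \<cdot> x" "itgt (fcod F) \<cdot> b = fob F \<cdot> y"
  define G where "G = discrete_ifun E Z (fdom F) x"
  define H where "H = discrete_ifun E Z (fdom F) y"
  have Z: "Z \<in> Ob E" using hom_Ob[OF x] by simp
  have GH: "G \<in> hom (Cat E) (discrete_icat E Z) (Dom (Cat E) F)"
    "H \<in> hom (Cat E) (discrete_icat E Z) (Dom (Cat E) F)"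
    unfolding hom_Cat G_def H_def
    using internal_functor_discrete[OF F'(1) x] internal_functor_discrete[OF F'(1) y]
    by (simp_all add: Cat_simps) (simp_all add: discrete_ifun_def)
  have d: "discrete_icat E Z \<in> Ob (Cat E)" using internal_category_discrete[OF Z] by (simp add: Cat_simps)
  have bij: "bij_betw (lwhisker (Cat E) F) (cells (Cat E) G H)
    (cells (Cat E) (F \<cdot>\<^bsub>Cat E\<^esub> G) (F \<cdot>\<^bsub>Cat E\<^esub> H))"
    using assms d GH unfolding fully_faithful_def by blast
  \<comment> \<open>Since \<open>F\<close> preserves units, composing with it sends the functor
    named by \<open>w\<close> to the one named by \<open>fob F \<cdot> w\<close>.\<close>
  have c: "F \<cdot>\<^bsub>Cat E\<^esub> discrete_ifun E Z (fdom F) w = discrete_ifun E Z (fcod F) (fob F \<cdot> w)"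
    if w: "w \<in> hom E Z (iob (fdom F))" for w
    using Comp_assoc[OF w A(5) F'(4)] Comp_assoc[OF w F'(3) B(5)] F'(7)
    by (simp add: Cat_simps discrete_ifun_def)
  have cell: "\<lparr>ndom = G, ncod = H, ncomp = a\<rparr> \<in> cells (Cat E) G H"
    if "a \<in> hom E Z (iarr (fdom F))" "isrc (fdom F) \<cdot> a = x" "itgt (fdom F) \<cdot> a = y" for a
    unfolding cells_Cat G_def H_def using internal_nat_discrete[OF F'(1) that(1)] that by simp
  have GF: "fcod G = fdom F" by (simp add: G_def discrete_ifun_def)
  show "\<exists>!a. a \<in> hom E Z (iarr (fdom F)) \<and> isrc (fdom F) \<cdot> a = x \<and> itgt (fdom F) \<cdot> a = y \<and>
      farr F \<cdot> a = b"
  proof (rule ex_ex1I)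
    have "\<lparr>ndom = F \<cdot>\<^bsub>Cat E\<^esub> G, ncod = F \<cdot>\<^bsub>Cat E\<^esub> H, ncomp = b\<rparr> \<in>
      cells (Cat E) (F \<cdot>\<^bsub>Cat E\<^esub> G) (F \<cdot>\<^bsub>Cat E\<^esub> H)"
      unfolding cells_Cat G_def H_def c[OF x] c[OF y] using internal_nat_discrete[OF F'(2) b] s by simp
    then obtain \<alpha> where \<alpha>: "\<alpha> \<in> cells (Cat E) G H"
      and l: "lwhisker (Cat E) F \<alpha> = \<lparr>ndom = F \<cdot>\<^bsub>Cat E\<^esub> G, ncod = F \<cdot>\<^bsub>Cat E\<^esub> H, ncomp = b\<rparr>"
      using bij unfolding bij_betw_def by (metis (no_types, lifting) imageE)
    have a: "internal_nat E \<alpha>" "ndom \<alpha> = G" "ncod \<alpha> = H" using \<alpha> by (simp_all add: cells_Cat)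
    note N = inatD[OF a refl GF]
    have "farr F \<cdot> ncomp \<alpha> = b" using l lwhisker_Cat[OF F \<alpha> GF] by simp
    then show "\<exists>a. a \<in> hom E Z (iarr (fdom F)) \<and> isrc (fdom F) \<cdot> a = x \<and> itgt (fdom F) \<cdot> a = y \<and>
      farr F \<cdot> a = b"
      using N(5-7) by (intro exI[of _ "ncomp \<alpha>"]) (simp add: G_def H_def discrete_ifun_def discrete_icat_def)
  next
    fix a a'
    assume h: "a \<in> hom E Z (iarr (fdom F)) \<and> isrc (fdom F) \<cdot> a = x \<and> itgt (fdom F) \<cdot> a = y \<and> farr F \<cdot> a = b"
      and h': "a' \<in> hom E Z (iarr (fdom F)) \<and> isrc (fdom F) \<cdot> a' = x \<and> itgt (fdom F) \<cdot> a' = y \<and> farr F \<cdot> a' = b"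
    note k = cell[of a] and k' = cell[of a']
    have "lwhisker (Cat E) F \<lparr>ndom = G, ncod = H, ncomp = a\<rparr> =
      lwhisker (Cat E) F \<lparr>ndom = G, ncod = H, ncomp = a'\<rparr>"
      using lwhisker_Cat[OF F _ GF, OF k] lwhisker_Cat[OF F _ GF, OF k'] h h' by simp
    then have "\<lparr>ndom = G, ncod = H, ncomp = a\<rparr> = \<lparr>ndom = G, ncod = H, ncomp = a'\<rparr>"
      using bij k k' h h' unfolding bij_betw_def by (blast dest: inj_onD)
    then show "a = a'" by simp
  qed
qed

section \<open>Fully faithful functors with a prescribed object part\<close>

text \<open>The arrows of \<open>B\<close> are pulled back along \<open>m\<close> at both ends. For
  monic \<open>m\<close> this is the full subcategory on \<open>m\<close>; for discrete
  \<open>B\<close> it is the kernel pair of \<open>m\<close>.\<close>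

lemma ex_internally_ff:
  assumes B: "internal_category E B" and m: "m \<in> hom E M (iob B)"
  obtains F where "internally_ff E F" "fcod F = B" "fob F = m" "iob (fdom F) = M"
proof -
  note D = icatD[OF B]
  have M: "M \<in> Ob E" using hom_Ob[OF m] by simp
  \<comment> \<open>Two successive pullbacks build \<open>R\<close>: first pairs of \<open>x\<close>
    and \<open>b\<close> with \<open>isrc B \<cdot> b = m \<cdot> x\<close>, then in addition
    \<open>y\<close> with \<open>itgt B \<cdot> b = m \<cdot> y\<close>. The resulting projections
    are \<open>s\<close>, \<open>k\<close> and \<open>t\<close>.\<close>
  define d1 where "d1 = pb1 E m (isrc B)"
  define d2 where "d2 = pb2 E m (isrc B)"
  note P = pb_hom[OF m D(3), folded d1_def d2_def]
  note td = Comp_hom[OF P(2) D(4)]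
  define c1 where "c1 = pb1 E (itgt B \<cdot> d2) m"
  define t where "t = pb2 E (itgt B \<cdot> d2) m"
  define R where "R = pbo E (itgt B \<cdot> d2) m"
  note Q = pb_hom[OF td m, folded c1_def t_def R_def]
  define s where "s = d1 \<cdot> c1"
  define k where "k = d2 \<cdot> c1"
  have s: "s \<in> hom E R M" unfolding s_def using Comp_hom[OF Q(1) P(1)] .
  have t: "t \<in> hom E R M" by (rule Q(2))
  have k: "k \<in> hom E R (iarr B)" unfolding k_def using Comp_hom[OF Q(1) P(2)] .
  have sk: "isrc B \<cdot> k = m \<cdot> s"
    using Comp_assoc[OF Q(1) P(2) D(3)] Comp_assoc[OF Q(1) P(1) m] P(3) by (simp add: k_def s_def)
  have tk: "itgt B \<cdot> k = m \<cdot> t"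
    using Comp_assoc[OF Q(1) P(2) D(4)] Q(3) by (simp add: k_def)
  \<comment> \<open>This universal property is already the full faithfulness of the functor under
    construction. It also supplies the unit and the multiplication, and \<open>cancel\<close>
    transfers their laws from \<open>B\<close>.\<close>
  have U: "\<exists>!a. a \<in> hom E Z R \<and> s \<cdot> a = x \<and> t \<cdot> a = y \<and> k \<cdot> a = b"
    if x: "x \<in> hom E Z M" and y: "y \<in> hom E Z M" and b: "b \<in> hom E Z (iarr B)"
      and e: "isrc B \<cdot> b = m \<cdot> x" "itgt B \<cdot> b = m \<cdot> y" for Z x y b
  proof -
    have sa: "s \<cdot> a = d1 \<cdot> c1 \<cdot> a" "k \<cdot> a = d2 \<cdot> c1 \<cdot> a" if "a \<in> hom E Z R" for a
      unfolding s_def k_def using Comp_assoc[OF that Q(1) P(1)] Comp_assoc[OF that Q(1) P(2)] .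
    define w where "w = tup E m (isrc B) x b"
    note W = tup[OF m D(3) x b e(1)[symmetric], folded w_def d1_def d2_def]
    have e': "(itgt B \<cdot> d2) \<cdot> w = m \<cdot> y" using Comp_assoc[OF W(1) P(2) D(4)] W(3) e(2) by simp
    note V = tup[OF td m W(1) y e', folded c1_def t_def R_def]
    show ?thesis
    proof (rule ex1I[of _ "tup E (itgt B \<cdot> d2) m w y"])
      show "tup E (itgt B \<cdot> d2) m w y \<in> hom E Z R \<and> s \<cdot> tup E (itgt B \<cdot> d2) m w y = x \<and>
        t \<cdot> tup E (itgt B \<cdot> d2) m w y = y \<and> k \<cdot> tup E (itgt B \<cdot> d2) m w y = b"
        using V W sa[OF V(1)] by simp
      fix a assume a: "a \<in> hom E Z R \<and> s \<cdot> a = x \<and> t \<cdot> a = y \<and> k \<cdot> a = b"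
      then have ah: "a \<in> hom E Z R" by simp
      have "w = c1 \<cdot> a"
        unfolding w_def using a sa[OF ah]
        by (intro tup_unique[OF m D(3) x b e(1)[symmetric]] Comp_hom[OF ah Q(1)])
          (simp_all add: d1_def d2_def)
      then show "a = tup E (itgt B \<cdot> d2) m w y"
        using a by (intro tup_unique[OF td m W(1) y e', symmetric]) (simp_all add: c1_def t_def R_def)
    qed
  qed
  have cancel: "a = a'" if "a \<in> hom E Z R" "a' \<in> hom E Z R" "s \<cdot> a = s \<cdot> a'" "t \<cdot> a = t \<cdot> a'" "k \<cdot> a = k \<cdot> a'"
    for Z a a'
  proof -
    have "isrc B \<cdot> k \<cdot> a = m \<cdot> s \<cdot> a" "itgt B \<cdot> k \<cdot> a = m \<cdot> t \<cdot> a"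
      using Comp_assoc[OF that(1) k D(3)] Comp_assoc[OF that(1) k D(4)] Comp_assoc[OF that(1) s m]
        Comp_assoc[OF that(1) t m] sk tk by simp_all
    from U[OF Comp_hom[OF that(1) s] Comp_hom[OF that(1) t] Comp_hom[OF that(1) k] this]
    show ?thesis using that by metis
  qed
  have ka: "k \<cdot> a \<in> hom E Z (iarr B)" "isrc B \<cdot> k \<cdot> a = m \<cdot> s \<cdot> a" "itgt B \<cdot> k \<cdot> a = m \<cdot> t \<cdot> a"
    if a: "a \<in> hom E Z R" for a Z
    using Comp_hom[OF a k] Comp_assoc[OF a k D(3)] Comp_assoc[OF a k D(4)] Comp_assoc[OF a s m]
      Comp_assoc[OF a t m] sk tk by simp_all
  have "isrc B \<cdot> iunit B \<cdot> m = m \<cdot> Ide E M" "itgt B \<cdot> iunit B \<cdot> m = m \<cdot> Ide E M"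
    using Comp_assoc[OF m D(5,3)] Comp_assoc[OF m D(5,4)] D(7,8) Ide_Comp[OF m] Comp_Ide[OF m] by simp_all
  from U[OF Ide_hom[OF M] Ide_hom[OF M] Comp_hom[OF m D(5)] this]
  obtain i where i: "i \<in> hom E M R" "s \<cdot> i = Ide E M" "t \<cdot> i = Ide E M" "k \<cdot> i = iunit B \<cdot> m" by blast
  define p where "p = pb1 E t s"
  define q where "q = pb2 E t s"
  note T = pb_hom[OF t s, folded p_def q_def]
  \<comment> \<open>The multiplication is the lift of the composite in \<open>B\<close> of the image
    of the universal composable pair.\<close>
  have pq: "itgt B \<cdot> k \<cdot> p = isrc B \<cdot> k \<cdot> q" using ka[OF T(1)] ka[OF T(2)] T(3) by simp
  note kpq = icomp_hom[OF B ka(1)[OF T(1)] ka(1)[OF T(2)] pq]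
  have "isrc B \<cdot> icomp E B (k \<cdot> p) (k \<cdot> q) = m \<cdot> s \<cdot> p" "itgt B \<cdot> icomp E B (k \<cdot> p) (k \<cdot> q) = m \<cdot> t \<cdot> q"
    using kpq ka[OF T(1)] ka[OF T(2)] by simp_all
  from U[OF Comp_hom[OF T(1) s] Comp_hom[OF T(2) t] kpq(1) this]
  obtain \<mu> where \<mu>: "\<mu> \<in> hom E (pbo E t s) R" "s \<cdot> \<mu> = s \<cdot> p" "t \<cdot> \<mu> = t \<cdot> q"
    "k \<cdot> \<mu> = icomp E B (k \<cdot> p) (k \<cdot> q)" by blast
  define C where "C = \<lparr>iob = M, iarr = R, isrc = s, itgt = t, iunit = i, imul = \<mu>\<rparr>"
  have C: "iob C = M" "iarr C = R" "isrc C = s" "itgt C = t" "iunit C = i" "imul C = \<mu>"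
    by (simp_all add: C_def)
  have comp: "icomp E C a b \<in> hom E Z R" "s \<cdot> icomp E C a b = s \<cdot> a" "t \<cdot> icomp E C a b = t \<cdot> b"
    "k \<cdot> icomp E C a b = icomp E B (k \<cdot> a) (k \<cdot> b)"
    if a: "a \<in> hom E Z R" and b: "b \<in> hom E Z R" and e: "t \<cdot> a = s \<cdot> b" for a b Z
  proof -
    define v where "v = tup E t s a b"
    note V = tup[OF t s a b e, folded v_def p_def q_def]
    have c: "icomp E C a b = \<mu> \<cdot> v" by (simp add: icomp_def C v_def)
    show "icomp E C a b \<in> hom E Z R" using c Comp_hom[OF V(1) \<mu>(1)] by simp
    show "s \<cdot> icomp E C a b = s \<cdot> a" "t \<cdot> icomp E C a b = t \<cdot> b"
      using c V \<mu> Comp_assoc[OF V(1) \<mu>(1) s] Comp_assoc[OF V(1) \<mu>(1) t]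
        Comp_assoc[OF V(1) T(1) s] Comp_assoc[OF V(1) T(2) t] by simp_all
    show "k \<cdot> icomp E C a b = icomp E B (k \<cdot> a) (k \<cdot> b)"
      using c V \<mu> Comp_assoc[OF V(1) \<mu>(1) k] Comp_assoc[OF V(1) T(1) k] Comp_assoc[OF V(1) T(2) k]
        icomp_Comp[OF B ka(1)[OF T(1)] ka(1)[OF T(2)] pq V(1)] by simp
  qed
  have ix: "i \<cdot> x \<in> hom E Z R" "s \<cdot> i \<cdot> x = x" "t \<cdot> i \<cdot> x = x" "k \<cdot> i \<cdot> x = iunit B \<cdot> m \<cdot> x"
    if x: "x \<in> hom E Z M" for x Z
    using Comp_hom[OF x i(1)] Comp_assoc[OF x i(1) s] Comp_assoc[OF x i(1) t] Comp_assoc[OF x i(1) k]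
      Comp_assoc[OF x m D(5)] i Ide_Comp[OF x] by simp_all
  \<comment> \<open>In each law the two sides agree under \<open>s\<close> and \<open>t\<close>, and
    under \<open>k\<close> they become the corresponding law of \<open>B\<close>.\<close>
  have iC: "internal_category E C"
  proof (rule icatI, unfold C)
    fix Z a assume a: "a \<in> hom E Z R"
    note as = ix[OF Comp_hom[OF a s]] and at = ix[OF Comp_hom[OF a t]]
    show "icomp E C (i \<cdot> s \<cdot> a) a = a \<and> icomp E C a (i \<cdot> t \<cdot> a) = a"
      by (rule conjI; rule cancel[of _ Z])
        (use as at comp[OF as(1) a] comp[OF a at(1)] a ka[OF a]
        icomp_unit_left[OF B ka(1,2)[OF a]] icomp_unit_right[OF B ka(1,3)[OF a]] in simp_all)
  next
    fix Z a b c assume h: "a \<in> hom E Z R" "b \<in> hom E Z R" "c \<in> hom E Z R" and e: "t \<cdot> a = s \<cdot> b" "t \<cdot> b = s \<cdot> c"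
    note ab = comp[OF h(1,2) e(1)] and bc = comp[OF h(2,3) e(2)]
    have e': "t \<cdot> icomp E C a b = s \<cdot> c" "t \<cdot> a = s \<cdot> icomp E C b c" using ab bc e by simp_all
    note l = comp[OF ab(1) h(3) e'(1)] and r = comp[OF h(1) bc(1) e'(2)]
    have e0: "icomp E B (icomp E B (k \<cdot> a) (k \<cdot> b)) (k \<cdot> c) = icomp E B (k \<cdot> a) (icomp E B (k \<cdot> b) (k \<cdot> c))"
      using ka[OF h(1)] ka[OF h(2)] ka[OF h(3)] e by (intro icomp_assoc[OF B]) simp_all
    show "icomp E C (icomp E C a b) c = icomp E C a (icomp E C b c)"
      by (rule cancel[of _ Z])
        (use e0 l r ab bc in simp_all)
  qed (use M hom_Ob[OF s] s t i \<mu> comp in simp_all)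
  define F where "F = \<lparr>fdom = C, fcod = B, fob = m, farr = k\<rparr>"
  have "internal_functor E F"
    by (rule ifunI[OF iC B]) (use m k sk tk i comp C in \<open>simp_all add: F_def\<close>)
  then have "internally_ff E F"
    unfolding internally_ff_def using U by (simp add: F_def C)
  then show thesis using that by (simp add: F_def C)
qed

section \<open>Full monomorphisms and acute functors in terms of object parts\<close>

text \<open>Functors out of discrete categories turn injectivity on functors into cancellation of
  generalised objects. Conversely, uniqueness in \<open>internally_ff_lift\<close> shows that a
  functor into the domain of \<open>F\<close> is determined by its object part and its composite
  with \<open>F\<close>.\<close>

lemma full_mono_iff:
  "full_mono (Cat E) F \<longleftrightarrow> internally_ff E F \<and> monic E (fob F)"
proof
  assume f: "full_mono (Cat E) F"
  then have ff: "internally_ff E F"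
    using fully_faithful_imp_internally_ff unfolding full_mono_def by blast
  note F = internally_ffD(1)[OF ff refl refl]
  note F' = ifunD[OF F refl refl]
  note A = icatD[OF F'(1)] and B = icatD[OF F'(2)]
  have d: "Dom E (fob F) = iob (fdom F)" "fob F \<in> Ar E" using F'(3) by (auto simp: hom_def)
  have "monic E (fob F)"
    unfolding monic_def
  proof (intro conjI allI ballI impI, unfold d(1))
    fix Z g h
    assume g: "g \<in> hom E Z (iob (fdom F))" and h: "h \<in> hom E Z (iob (fdom F))"
      and eq: "fob F \<cdot> g = fob F \<cdot> h"
    have Z: "discrete_icat E Z \<in> Ob (Cat E)"
      using internal_category_discrete hom_Ob[OF g] by (simp add: Cat_simps)
    let ?D = "discrete_ifun E Z (fdom F)"
    have D: "?D w \<in> hom (Cat E) (discrete_icat E Z) (Dom (Cat E) F)" if "w \<in> hom E Z (iob (fdom F))" for w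
      unfolding hom_Cat using internal_functor_discrete[OF F'(1) that]
      by (simp add: Cat_simps) (simp add: discrete_ifun_def)
    have c: "F \<cdot>\<^bsub>Cat E\<^esub> ?D w = discrete_ifun E Z (fcod F) (fob F \<cdot> w)"
      if w: "w \<in> hom E Z (iob (fdom F))" for w
      using Comp_assoc[OF w A(5) F'(4)] Comp_assoc[OF w F'(3) B(5)] F'(7)
      by (simp add: Cat_simps discrete_ifun_def)
    have "F \<cdot>\<^bsub>Cat E\<^esub> ?D g = F \<cdot>\<^bsub>Cat E\<^esub> ?D h" using c[OF g] c[OF h] eq by simp
    then have "?D g = ?D h"
      using f Z D[OF g] D[OF h] unfolding full_mono_def by (blast dest: inj_onD)
    then show "g = h" by (simp add: discrete_ifun_def)
  qed (rule d(2))
  with ff show "internally_ff E F \<and> monic E (fob F)" ..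
next
  assume "internally_ff E F \<and> monic E (fob F)"
  then have ff: "internally_ff E F" and m: "monic E (fob F)" by auto
  have "G = H" if "G \<in> hom (Cat E) Z (Dom (Cat E) F)" "H \<in> hom (Cat E) Z (Dom (Cat E) F)"
    and eq: "F \<cdot>\<^bsub>Cat E\<^esub> G = F \<cdot>\<^bsub>Cat E\<^esub> H" for Z G H
  proof -
    note F = internally_ffD(1)[OF ff refl refl]
    note F' = ifunD[OF F refl refl]
    have GH: "G \<in> hom (Cat E) Z (fdom F)" "H \<in> hom (Cat E) Z (fdom F)"
      using that by (simp_all add: Cat_simps(3))
    then have G: "internal_functor E G" "fdom G = Z" "fcod G = fdom F"
      and H: "internal_functor E H" "fdom H = Z" "fcod H = fdom F" by (simp_all add: hom_Cat)
    note G' = ifunD[OF G] and H' = ifunD[OF H]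
    have e: "fob F \<cdot> fob G = fob F \<cdot> fob H" using eq by (simp add: Cat_simps)
    then have o: "fob G = fob H"
      using m G'(3) H'(3) F'(3) unfolding monic_def by (auto simp: hom_def)
    have "internal_functor E (F \<cdot>\<^bsub>Cat E\<^esub> G)" "fdom (F \<cdot>\<^bsub>Cat E\<^esub> G) = Z" "fcod (F \<cdot>\<^bsub>Cat E\<^esub> G) = fcod F"
      "fob F \<cdot> fob G = fob (F \<cdot>\<^bsub>Cat E\<^esub> G)"
      using Comp_ifun[OF G(1) F G(3)] G by (simp_all add: Cat_simps)
    from internally_ff_lift[OF ff refl refl this(1-3) G'(3) this(4)]
    show ?thesis using GH o eq by metis
  qed
  then show "full_mono (Cat E) F"
    unfolding full_mono_def inj_on_def using internally_ff_imp_fully_faithful[OF ff] by blast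
qed

text \<open>The diagonal is found on objects, where the right-hand side is monic, and then lifted
  through the fully faithful \<open>J\<close>; the condition on 2-cells is automatic.\<close>

lemma acuteI:
  assumes F: "internal_functor E F" and o: "\<And>m. monic E m \<Longrightarrow> orthogonal E (fob F) m"
  shows "acute (Cat E) F"
  unfolding acute_def
proof (intro conjI allI impI)
  show FA: "F \<in> Ar (Cat E)" using F by (simp add: Cat_simps)
  fix J assume "full_mono (Cat E) J"
  then have J: "internally_ff E J" and m: "monic E (fob J)" by (simp_all add: full_mono_iff)
  note Jf = internally_ffD(1)[OF J refl refl]
  note F' = ifunD[OF F refl refl] and J' = ifunD[OF Jf refl refl]
  note A = icatD[OF F'(1)]
  have "orthogonal (Cat E) F J"
    unfolding orthogonal_def Cat_simps(3,4)
  proof (intro ballI impI)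
    fix P Q
    assume "P \<in> hom (Cat E) (fdom F) (fdom J)" "Q \<in> hom (Cat E) (fcod F) (fcod J)"
      and eq: "J \<cdot>\<^bsub>Cat E\<^esub> P = Q \<cdot>\<^bsub>Cat E\<^esub> F"
    then have P: "internal_functor E P" "fdom P = fdom F" "fcod P = fdom J"
      and Q: "internal_functor E Q" "fdom Q = fcod F" "fcod Q = fcod J" by (simp_all add: hom_Cat)
    note P' = ifunD[OF P] and Q' = ifunD[OF Q]
    have eqs: "fob J \<cdot> fob P = fob Q \<cdot> fob F" "farr J \<cdot> farr P = farr Q \<cdot> farr F"
      using eq by (simp_all add: Cat_simps)
    have "\<exists>!u. u \<in> hom E (iob (fcod F)) (iob (fdom J)) \<and> fob J \<cdot> u = fob Q \<and> u \<cdot> fob F = fob P"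
      using o[OF m] P'(3) Q'(3) F'(3) J'(3) eqs(1) unfolding orthogonal_def by (auto simp: hom_def)
    then obtain u where u: "u \<in> hom E (iob (fcod F)) (iob (fdom J))" "fob J \<cdot> u = fob Q" "u \<cdot> fob F = fob P"
      and uu: "\<And>v. v \<in> hom E (iob (fcod F)) (iob (fdom J)) \<Longrightarrow> fob J \<cdot> v = fob Q \<Longrightarrow> v \<cdot> fob F = fob P \<Longrightarrow> v = u"
      by blast
    from internally_ff_lift[OF J refl refl Q u(1,2)]
    obtain H where H: "H \<in> hom (Cat E) (fcod F) (fdom J)" "fob H = u" "J \<cdot>\<^bsub>Cat E\<^esub> H = Q"
      and HH: "\<And>H'. H' \<in> hom (Cat E) (fcod F) (fdom J) \<Longrightarrow> fob H' = u \<Longrightarrow> J \<cdot>\<^bsub>Cat E\<^esub> H' = Q \<Longrightarrow> H' = H"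
      by blast
    have Hf: "internal_functor E H" "fdom H = fcod F" "fcod H = fdom J" using H(1) by (simp_all add: hom_Cat)
    note H' = ifunD[OF Hf]
    have e0: "farr J \<cdot> farr H = farr Q" using H(3) by (auto simp: Cat_simps)
    \<comment> \<open>The lift guarantees only the triangle over \<open>J\<close>. The other
      triangle holds on objects by the choice of \<open>u\<close>, and on arrows after applying
      \<open>J\<close>, hence on arrows.\<close>
    have "farr H \<cdot> farr F = farr P"
      by (rule internally_ff_cancel[OF J refl refl])
        (use e0 Comp_hom[OF F'(4) H'(4)] P' ifun_src[OF Hf F'(4)] F' eqs(2) u(3) H(2)
        Comp_assoc[OF F'(4) H'(4) J'(4)] Comp_assoc[OF A(3) F'(3) u(1)] Comp_assoc[OF A(4) F'(3) u(1)] in simp_all)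
    then have HF: "H \<cdot>\<^bsub>Cat E\<^esub> F = P" using u(3) H(2) P Hf by (simp add: Cat_simps)
    show "\<exists>!u. u \<in> hom (Cat E) (fcod F) (fdom J) \<and> J \<cdot>\<^bsub>Cat E\<^esub> u = Q \<and> u \<cdot>\<^bsub>Cat E\<^esub> F = P"
    proof (rule ex1I[of _ H])
      show "H \<in> hom (Cat E) (fcod F) (fdom J) \<and> J \<cdot>\<^bsub>Cat E\<^esub> H = Q \<and> H \<cdot>\<^bsub>Cat E\<^esub> F = P"
        using H HF by simp
      fix V assume V: "V \<in> hom (Cat E) (fcod F) (fdom J) \<and> J \<cdot>\<^bsub>Cat E\<^esub> V = Q \<and> V \<cdot>\<^bsub>Cat E\<^esub> F = P"
      then have "internal_functor E V" "fdom V = fcod F" "fcod V = fdom J" by (simp_all add: hom_Cat)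
      from ifunD(3)[OF this] have "fob V = u" using V by (intro uu) (auto simp: Cat_simps)
      then show "V = H" using V HH by blast
    qed
  qed
  then show "orthogonal2 (Cat E) F J"
    by (intro two_category.orthogonal2I two_category_Cat FA internally_ff_imp_fully_faithful J)
qed

section \<open>Sections of functors; acute functors have epic object part\<close>

text \<open>A section of the object part is a lift of the object part of the identity functor, so
  the identity functor itself lifts through \<open>F\<close>.\<close>

lemma has_section_CatI:
  assumes F: "internally_ff E F" and s: "has_section E (fob F)"
  shows "has_section (Cat E) F"
proof -
  note Ff = internally_ffD(1)[OF F refl refl]
  note F' = ifunD[OF Ff refl refl]
  have "Dom E (fob F) = iob (fdom F)" "Cod E (fob F) = iob (fcod F)" using F'(3) by (auto simp: hom_def)
  then obtain h where h: "h \<in> hom E (iob (fcod F)) (iob (fdom F))" "fob F \<cdot> h = Ide E (iob (fcod F))"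
    using s unfolding has_section_def by auto
  have "fdom (Ide (Cat E) (fcod F)) = fcod F" "fcod (Ide (Cat E) (fcod F)) = fcod F"
    "fob F \<cdot> h = fob (Ide (Cat E) (fcod F))"
    using h by (simp_all add: Cat_simps)
  from internally_ff_lift[OF F refl refl Ide_ifun[OF F'(2)] this(1,2) h(1) this(3)]
  show ?thesis unfolding has_section_def Cat_simps(3,4) by blast
qed

lemma has_section_fob:
  assumes F: "internal_functor E F" and s: "has_section (Cat E) F"
  shows "has_section E (fob F)"
proof -
  note F' = ifunD(3)[OF F refl refl]
  obtain S where S: "S \<in> hom (Cat E) (fcod F) (fdom F)" "F \<cdot>\<^bsub>Cat E\<^esub> S = Ide (Cat E) (fcod F)"
    using s unfolding has_section_def by (auto simp: Cat_simps(3,4))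
  then have "fob S \<in> hom E (iob (fcod F)) (iob (fdom F))" using ifunD(3)[of S] by (simp add: hom_Cat)
  moreover have "fob F \<cdot> fob S = Ide E (iob (fcod F))" using S(2) by (auto simp: Cat_simps)
  ultimately show ?thesis unfolding has_section_def using F' by (auto simp: hom_def)
qed

text \<open>Lifting the identity against the inclusion of the full subcategory on the image splits that
  inclusion, so its monic object part \<open>m\<close> is epic too.\<close>

lemma acute_epic_fob:
  assumes F: "acute (Cat E) F"
    and e: "epic E e" and m: "monic E m" and c: "Cod E e = Dom E m" and fm: "fob F = m \<cdot> e"
  shows "epic E (fob F)"
proof -
  have Ff: "internal_functor E F" using F by (simp add: acute_def Cat_simps)
  note F' = ifunD[OF Ff refl refl]
  define M where "M = Dom E m"
  have "e \<in> hom E (Dom E e) M" "m \<in> hom E M (Cod E m)"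
    using e m c by (auto simp: epic_def monic_def hom_def M_def)
  moreover from Comp_hom[OF this] F'(3) have "Dom E e = iob (fdom F)" "Cod E m = iob (fcod F)"
    by (auto simp: fm hom_def)
  ultimately have eh: "e \<in> hom E (iob (fdom F)) M" and mh: "m \<in> hom E M (iob (fcod F))" by simp_all
  obtain J where J: "internally_ff E J" "fcod J = fcod F" "fob J = m" "iob (fdom J) = M"
    using ex_internally_ff[OF F'(2) mh] .
  \<comment> \<open>The lift \<open>H\<close> of \<open>F\<close> along \<open>J\<close> with object
    part \<open>e\<close> is the top side of a square from \<open>F\<close> to \<open>J\<close>
    whose bottom side is the identity.\<close>
  have "e \<in> hom E (iob (fdom F)) (iob (fdom J))" "fob J \<cdot> e = fob F" using eh J fm by simp_all
  from internally_ff_lift[OF J(1) refl J(2) Ff refl refl this]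
  obtain H where H: "H \<in> hom (Cat E) (fdom F) (fdom J)" "J \<cdot>\<^bsub>Cat E\<^esub> H = F" by blast
  have I: "Ide (Cat E) (fcod F) \<in> hom (Cat E) (fcod F) (fcod J)"
    using Ide_ifun[OF F'(2)] J(2) by (simp add: hom_Cat) (simp add: Cat_simps)
  have IF: "Ide (Cat E) (fcod F) \<cdot>\<^bsub>Cat E\<^esub> F = F"
    using Ide_Comp[OF F'(3)] Ide_Comp[OF F'(4)] by (simp add: Cat_simps)
  have "full_mono (Cat E) J" using J m by (simp add: full_mono_iff)
  then have "orthogonal (Cat E) F J" using F unfolding acute_def orthogonal2_def by blast
  then obtain V where "V \<in> hom (Cat E) (fcod F) (fdom J)" "J \<cdot>\<^bsub>Cat E\<^esub> V = Ide (Cat E) (fcod F)"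
    using H I IF unfolding orthogonal_def Cat_simps(3,4) by metis
  then have "has_section (Cat E) J" unfolding has_section_def Cat_simps(3,4) J(2) by blast
  then have "has_section E m" using has_section_fob[OF internally_ffD(1)[OF J(1) refl refl]] J(3) by simp
  moreover have "m \<in> Ar E" using m by (simp add: monic_def)
  ultimately show ?thesis unfolding fm using epic_Comp[OF e _ c] has_section_epic by blast
qed

end

section \<open>The equivalence of the two axioms of choice\<close>

theorem theorem8p12:
  fixes E :: "('o, 'a) cat"
  assumes "category E"
    and "has_pullbacks E"
    and "has_finite_products E"
    and "orthogonal_factorisation_system E {e. epic E e} {m. monic E m}"
  shows "external_choice E \<longleftrightarrow> categorified_choice (Cat E)"
proof
  interpret pullback_category E
    using assms(1,2) by (simp add: pullback_category_def pullback_category_axioms_def)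
  {
    assume ac: "external_choice E"
    show "categorified_choice (Cat E)"
      unfolding categorified_choice_def
    proof (intro allI impI, elim conjE)
      fix F assume F: "acute (Cat E) F" "fully_faithful (Cat E) F"
      note ff = fully_faithful_imp_internally_ff[OF F(2)]
      \<comment> \<open>The factorisation system is applied to the object part, as
        \<open>acute_epic_fob\<close> requires an epic-monic factorisation of it.\<close>
      have "fob F \<in> Ar E" using ifunD(3)[OF internally_ffD(1)[OF ff refl refl] refl refl] by (simp add: hom_def)
      then obtain e m where "epic E e" "monic E m" "Cod E e = Dom E m" "fob F = m \<cdot>\<^bsub>E\<^esub> e"
        using assms(4) unfolding orthogonal_factorisation_system_def by blast
      from acute_epic_fob[OF F(1) this] have "has_section E (fob F)"
        using ac by (simp add: external_choice_def)
      then show "has_section (Cat E) F" by (rule has_section_CatI[OF ff])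
    qed
  next
    assume cc: "categorified_choice (Cat E)"
    show "external_choice E"
      unfolding external_choice_def
    proof (intro allI impI)
      fix e assume e: "epic E e"
      then have h: "e \<in> hom E (Dom E e) (Cod E e)" by (simp add: epic_def hom_def)
      \<comment> \<open>The discrete category turns the codomain of \<open>e\<close> into an object
        of objects, so that \<open>e\<close> becomes the object part of a fully faithful
        functor.\<close>
      then have "e \<in> hom E (Dom E e) (iob (discrete_icat E (Cod E e)))" by (simp add: discrete_icat_def)
      from ex_internally_ff[OF internal_category_discrete this] hom_Ob[OF h]
      obtain F where F: "internally_ff E F" "fob F = e" by blast
      note Ff = internally_ffD(1)[OF F(1) refl refl]
      \<comment> \<open>In the factorisation system the left class, here the epimorphisms, is
        orthogonal to the right class, here the monomorphisms; \<open>acuteI\<close> then makes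
        \<open>F\<close> acute.\<close>
      have "orthogonal E e m" if "monic E m" for m
        using assms(4) e that unfolding orthogonal_factorisation_system_def by blast
      then have "acute (Cat E) F" using F(2) by (intro acuteI[OF Ff]) simp
      then have "has_section (Cat E) F"
        using cc internally_ff_imp_fully_faithful[OF F(1)] unfolding categorified_choice_def by blast
      then show "has_section E e" using has_section_fob[OF Ff] F(2) by simp
    qed
  }
qed

end
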